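(* For the two-user Gaussian $X$-channel with delayed CSIT, the sum linear degrees of freedom equals $\frac{6}{5}$; that is, $\mathrm{DoF}_{\mathrm{L\text{-}sum}} = \max\{d_{11}+d_{12}+d_{21}+d_{22} : (d_{11},d_{12},d_{21},d_{22})\in\mathcal D\} = \frac{6}{5}$.
   Context: The two-user $X$-channel: two single-antenna transmitters $\mathrm{Tx}_1,\mathrm{Tx}_2$ and two single-antenna receivers $\mathrm{Rx}_1,\mathrm{Rx}_2$; each $\mathrm{Tx}_j$ has a separate message for each $\mathrm{Rx}_k$. At time $t$, $\mathbf y_k(t)=\mathbf g_{k1}(t)\mathbf x_1(t)+\mathbf g_{k2}(t)\mathbf x_2(t)+\mathbf z_k(t)$, $\mathbf z_k(t)\sim\mathcal{CN}(0,1)$, where the complex channel coefficients $\mathbf g_{kj}(t)$ are i.i.d. across time and users and drawn from a continuous distribution. Let $\mathcal G^{t}=\{\mathbf g_{kj}(s):k,j\in\{1,2\},1\le s\le t\}$. Delayed CSIT: at time $t$ the transmitters know only $\mathcal G^{t-1}$; receivers know $\mathcal G^t$. Linear coding scheme of block length $n$: $\mathrm{Tx}_j$ has a vector $\vec{\mathbf x}_{kj}\in\mathbb C^{m_{kj}(n)}$ of information symbols for $\mathrm{Rx}_k$; at time $t$ it uses precoding vectors $\vec{\mathbf v}_{kj}(t)=f^{(n)}_{k,j,t}(\mathcal G^{t-1})\in\mathbb C^{m_{kj}(n)}$ (deterministic functions of past channels) and sends $\mathbf x_j(t)=\vec{\mathbf v}_{1j}(t)^\top\vec{\mathbf x}_{1j}+\vec{\mathbf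 v}_{2j}(t)^\top\vec{\mathbf x}_{2j}$. Let $\mathbf V^n_{kj}\in\mathbb C^{n\times m_{kj}(n)}$ have $t$-th row $\vec{\mathbf v}_{kj}(t)^\top$, and let $\mathbf G^n_{kj}$ be the $n\times n$ diagonal matrix with $t$-th diagonal entry $\mathbf g_{kj}(t)$. For $k,j\in\{1,2\}$, $j'=3-j$, $k'=3-k$, let $\mathcal I_{kj}=\mathrm{colspan}(\mathbf G^n_{kj}\mathbf V^n_{k'j})\cup\mathrm{colspan}(\mathbf G^n_{kj'}\mathbf V^n_{kj'})\cup\mathrm{colspan}(\mathbf G^n_{kj'}\mathbf V^n_{k'j'})$ and $\mathcal I_{kj}^c$ its orthogonal complement in $\mathbb C^n$. Decodability: $\dim(\mathrm{Proj}_{\mathcal I_{kj}^c}\mathrm{colspan}(\mathbf G^n_{kj}\mathbf V^n_{kj}))=\dim(\mathrm{colspan}(\mathbf V^n_{kj}))=m_{kj}(n)$ for all $k,j$. A tuple $(d_{11},d_{12},d_{21},d_{22})$ is linearly achievable if there is a sequence of linear schemes (precoding functions) such that for each $n$ the decodability conditions hold with probability 1 and $d_{kj}=\lim_{n\to\infty}m_{kj}(n)/n$ for all $k,j$. $\mathcal D$ is the closure of the set of linearly achievable tuples. *)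

theory Defs
  imports "HOL-Probability.Probability" "HOL-Library.Function_Algebras"
begin

text \<open>Vectors of \<open>\<complex>\<^sup>n\<close> are functions \<open>nat \<Rightarrow> complex\<close> vanishing outside \<open>{..<n}\<close>
  (time index 0-based).  Complex scalar multiplication, span and dimension
  are the generic notions of HOL's Vector_Spaces instantiated at this scaling.\<close>

definition cscale :: "complex \<Rightarrow> (nat \<Rightarrow> complex) \<Rightarrow> (nat \<Rightarrow> complex)" where
  "cscale c v = (\<lambda>i. c * v i)"

definition cspan :: "(nat \<Rightarrow> complex) set \<Rightarrow> (nat \<Rightarrow> complex) set" where
  "cspan S = module.span cscale S"

definition cdim :: "(nat \<Rightarrow> complex) set \<Rightarrow> nat" where
  "cdim S = vector_space.dim cscale S"

definition cvecs :: "nat \<Rightarrow> (nat \<Rightarrow> complex) set" where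
  "cvecs n = {v. \<forall>i\<ge>n. v i = 0}"

definition cinner :: "nat \<Rightarrow> (nat \<Rightarrow> complex) \<Rightarrow> (nat \<Rightarrow> complex) \<Rightarrow> complex" where
  "cinner n u v = (\<Sum>i<n. u i * cnj (v i))"

definition orth :: "nat \<Rightarrow> (nat \<Rightarrow> complex) set \<Rightarrow> (nat \<Rightarrow> complex) set" where
  "orth n S = {v \<in> cvecs n. \<forall>u\<in>S. cinner n v u = 0}"

definition proj :: "nat \<Rightarrow> (nat \<Rightarrow> complex) set \<Rightarrow> (nat \<Rightarrow> complex) \<Rightarrow> (nat \<Rightarrow> complex)" where
  "proj n U v = (THE p. p \<in> U \<and> (\<forall>u\<in>U. cinner n (v - p) u = 0))"

definition colspan :: "nat \<Rightarrow> nat \<Rightarrow> (nat \<Rightarrow> nat \<Rightarrow> complex) \<Rightarrow> (nat \<Rightarrow> complex) set" where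
  "colspan n m A = cspan ((\<lambda>c. (\<lambda>t. if t < n then A t c else 0)) ` {..<m})"

text \<open>A channel realisation for block length \<open>n\<close>: \<open>H (t,k,j) = g_kj(t)\<close>,
  \<open>t < n\<close>, \<open>k,j \<in> {1,2}\<close>.  Its law: i.i.d. \<open>\<mu>\<close> over all coordinates.\<close>
definition chan_idx :: "nat \<Rightarrow> (nat \<times> nat \<times> nat) set" where
  "chan_idx n = {..<n} \<times> {1,2} \<times> {1,2}"

definition chan_space :: "complex measure \<Rightarrow> nat \<Rightarrow> (nat \<times> nat \<times> nat \<Rightarrow> complex) measure" where
  "chan_space \<mu> n = PiM (chan_idx n) (\<lambda>_. \<mu>)"

text \<open>A linear scheme of block length \<open>n\<close>: numbers of symbols \<open>m k j\<close> and
  precoders \<open>V k j t H c\<close> = \<open>c\<close>-th entry of \<open>v_kj(t)\<close> under realisation \<open>H\<close>.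
  Delayed CSIT: \<open>v_kj(t)\<close> is a (measurable) deterministic function of \<open>G^{t-1}\<close>,
  i.e. depends on \<open>H\<close> only through times \<open>s < t\<close>.\<close>
definition delayed_csit ::
  "complex measure \<Rightarrow> nat \<Rightarrow> (nat \<Rightarrow> nat \<Rightarrow> nat \<Rightarrow> (nat \<times> nat \<times> nat \<Rightarrow> complex) \<Rightarrow> nat \<Rightarrow> complex) \<Rightarrow> bool" where
  "delayed_csit \<mu> n V \<longleftrightarrow>
     (\<forall>k\<in>{1,2}. \<forall>j\<in>{1,2}. \<forall>t<n. \<forall>c.
        (\<forall>H H'. (\<forall>s<t. \<forall>k'\<in>{1,2}. \<forall>j'\<in>{1,2}. H (s,k',j') = H' (s,k',j'))
                 \<longrightarrow> V k j t H c = V k j t H' c)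
      \<and> (\<lambda>H. V k j t H c) \<in> borel_measurable (chan_space \<mu> n))"

definition GVspan ::
  "nat \<Rightarrow> (nat \<Rightarrow> nat \<Rightarrow> nat) \<Rightarrow> (nat \<Rightarrow> nat \<Rightarrow> nat \<Rightarrow> (nat \<times> nat \<times> nat \<Rightarrow> complex) \<Rightarrow> nat \<Rightarrow> complex)
     \<Rightarrow> (nat \<times> nat \<times> nat \<Rightarrow> complex) \<Rightarrow> nat \<Rightarrow> nat \<Rightarrow> nat \<Rightarrow> (nat \<Rightarrow> complex) set" where
  "GVspan n m V H k j k2 = colspan n (m k2 j) (\<lambda>t c. H (t,k,j) * V k2 j t H c)"

definition decodable ::
  "nat \<Rightarrow> (nat \<Rightarrow> nat \<Rightarrow> nat) \<Rightarrow> (nat \<Rightarrow> nat \<Rightarrow> nat \<Rightarrow> (nat \<times> nat \<times> nat \<Rightarrow> complex) \<Rightarrow> nat \<Rightarrow> complex)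
     \<Rightarrow> (nat \<times> nat \<times> nat \<Rightarrow> complex) \<Rightarrow> bool" where
  "decodable n m V H \<longleftrightarrow>
     (\<forall>k\<in>{1,2}. \<forall>j\<in>{1,2}.
        (let k' = 3 - k; j' = 3 - j;
             I = GVspan n m V H k j k' \<union> GVspan n m V H k j' k \<union> GVspan n m V H k j' k'
         in cdim (proj n (orth n I) ` GVspan n m V H k j k) = m k j
          \<and> cdim (colspan n (m k j) (\<lambda>t c. V k j t H c)) = m k j))"

definition lin_achievable :: "complex measure \<Rightarrow> (real \<times> real \<times> real \<times> real) set" where
  "lin_achievable \<mu> =
     {(d11, d12, d21, d22). \<exists>m V.
        (\<forall>n. delayed_csit \<mu> n (V n)) \<and>
        (\<forall>n. AE H in chan_space \<mu> n. decodable n (m n) (V n) H) \<and>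
        (\<lambda>n. real (m n 1 1) / real n) \<longlonglongrightarrow> d11 \<and>
        (\<lambda>n. real (m n 1 2) / real n) \<longlonglongrightarrow> d12 \<and>
        (\<lambda>n. real (m n 2 1) / real n) \<longlonglongrightarrow> d21 \<and>
        (\<lambda>n. real (m n 2 2) / real n) \<longlonglongrightarrow> d22}"

definition DoF_region :: "complex measure \<Rightarrow> (real \<times> real \<times> real \<times> real) set" where
  "DoF_region \<mu> = closure (lin_achievable \<mu>)"

end

theory Submission
  imports Defs
begin

text \<open>Decodability says that the symbols wanted by a receiver are determined by its noiseless observation,
  so everything reduces to homogeneous linear systems.

  \<^bold>\<open>Converse.\<close>  Consider the \<open>M\<close> symbols intended for receiver \<open>k\<close>, let \<open>K\<close> be the space of symbol vectors
  invisible to the other receiver \<open>k'\<close>, and let \<open>T\<close> be the set of times at which \<open>k'\<close> sees something new about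
  these symbols.  As the current channel is independent of the precoders, almost surely at every time outside \<open>T\<close>
  the contributions of the two transmitters vanish separately on \<open>K\<close>.  Hence for \<open>z, z' \<in> K\<close> the vector
  composed of the first transmitter's symbols of \<open>z\<close> and the second transmitter's symbols of \<open>z'\<close> is seen by
  receiver \<open>k\<close> only at times in \<open>T\<close>, and decodability at \<open>k\<close> makes the resulting map from \<open>K \<times> K\<close> to \<open>\<complex>\<^sup>T\<close>
  injective.  Therefore \<open>2 (M - |T|) \<le> |T|\<close>.  The interference of these symbols at \<open>k'\<close> has dimension \<open>|T|\<close>, so
  \<open>M' + |T| \<le> n\<close> for the number \<open>M'\<close> of symbols wanted there.  This gives \<open>2 M + 3 M' \<le> 3 n\<close>; adding the
  inequality with the receivers exchanged yields \<open>5 (M + M') \<le> 6 n\<close>.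

  \<^bold>\<open>Achievability.\<close>  Blocks of five slots carry six symbols, by retransmitting what one receiver overheard.\<close>

section \<open>Orthogonal projections in \<open>\<complex>\<^sup>n\<close>\<close>

interpretation cvs: vector_space cscale
  by unfold_locales (auto simp: cscale_def algebra_simps fun_eq_iff)

lemma sum_cscale_apply: "(\<Sum>c\<in>A. cscale (p c) (f c)) t = (\<Sum>c\<in>A. p c * f c t)"
  by (induction A rule: infinite_finite_induct) (auto simp: cscale_def)

lemma cspan_image_iff:
  "v \<in> cspan (f ` {..<m::nat}) \<longleftrightarrow> (\<exists>p. v = (\<Sum>c<m. cscale (p c) (f c)))"
proof
  assume "v \<in> cspan (f ` {..<m})"
  then show "\<exists>p. v = (\<Sum>c<m. cscale (p c) (f c))"
    unfolding cspan_def
  proof (induction rule: cvs.span_induct_alt)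
    case base
    show ?case by (intro exI[of _ "\<lambda>_. 0"]) simp
  next
    case (step a x y)
    then obtain p c0 where p: "y = (\<Sum>c<m. cscale (p c) (f c))" and c0: "c0 < m" "x = f c0"
      by auto
    have "cscale a (f c0) = (\<Sum>c<m. cscale (if c = c0 then a else 0) (f c))"
    proof -
      have "(\<Sum>c<m. cscale (if c = c0 then a else 0) (f c))
          = (\<Sum>c<m. if c = c0 then cscale a (f c) else 0)"
        by (intro sum.cong) auto
      also have "\<dots> = cscale a (f c0)"
        using c0 by (subst sum.delta) auto
      finally show ?thesis ..
    qed
    then have "cscale a x + y = (\<Sum>c<m. cscale (p c + (if c = c0 then a else 0)) (f c))"
      using p c0 by (simp add: cvs.scale_left_distrib sum.distrib add.commute)
    then show ?case by (intro exI)
  qed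
next
  assume "\<exists>p. v = (\<Sum>c<m. cscale (p c) (f c))"
  then show "v \<in> cspan (f ` {..<m})"
    unfolding cspan_def by (auto intro!: cvs.span_sum cvs.span_scale intro: cvs.span_base)
qed

lemma cdim_cspan_image_eq_iff:
  "cdim (cspan (f ` {..<m::nat})) = m \<longleftrightarrow>
     (\<forall>p. (\<Sum>c<m. cscale (p c) (f c)) = 0 \<longrightarrow> (\<forall>c<m. p c = 0))"
proof (intro iffI allI impI)
  fix p c0
  assume dim: "cdim (cspan (f ` {..<m})) = m"
    and z: "(\<Sum>c<m. cscale (p c) (f c)) = 0" and c0: "c0 < m"
  show "p c0 = 0"
  proof (rule ccontr)
    assume nz: "p c0 \<noteq> 0"
    let ?S = "f ` ({..<m} - {c0})"
    have "(\<Sum>c<m. cscale (p c) (f c))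
        = cscale (p c0) (f c0) + (\<Sum>c\<in>{..<m}-{c0}. cscale (p c) (f c))"
      using c0 by (subst sum.remove[of _ c0]) auto
    then have "cscale (p c0) (f c0) = - (\<Sum>c\<in>{..<m}-{c0}. cscale (p c) (f c))"
      using z by (simp add: eq_neg_iff_add_eq_0)
    moreover have "- (\<Sum>c\<in>{..<m}-{c0}. cscale (p c) (f c)) \<in> cvs.span ?S"
      by (intro cvs.span_neg cvs.span_sum cvs.span_scale cvs.span_base) auto
    ultimately have "cscale (inverse (p c0)) (cscale (p c0) (f c0)) \<in> cvs.span ?S"
      by (metis cvs.span_scale)
    then have f0: "f c0 \<in> cvs.span ?S"
      using nz by simp
    have "f ` {..<m} \<subseteq> cvs.span ?S"
      using f0 by (auto intro: cvs.span_base)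
    then have "cvs.dim (f ` {..<m}) \<le> card ?S"
      by (intro cvs.dim_le_card) auto
    also have "\<dots> \<le> card ({..<m} - {c0})"
      by (intro card_image_le) auto
    also have "\<dots> < m"
      using c0 by simp
    finally show False
      using dim by (simp add: cdim_def cspan_def)
  qed
next
  assume *: "\<forall>p. (\<Sum>c<m. cscale (p c) (f c)) = 0 \<longrightarrow> (\<forall>c<m. p c = 0)"
  have inj: "inj_on f {..<m}"
  proof (rule inj_onI, rule ccontr)
    fix a b assume ab: "a \<in> {..<m}" "b \<in> {..<m}" "f a = f b" "a \<noteq> b"
    let ?p = "\<lambda>c. if c = a then 1 else if c = b then -1 else (0::complex)"
    have "(\<Sum>c<m. cscale (?p c) (f c)) = (\<Sum>c\<in>{a,b}. cscale (?p c) (f c))"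
      using ab by (intro sum.mono_neutral_right) auto
    also have "\<dots> = 0"
      using ab by auto
    finally show False
      using *[rule_format, of ?p a] ab(1) by simp
  qed
  have "cvs.independent (f ` {..<m})"
  proof (rule cvs.independent_if_scalars_zero)
    fix g x assume g: "(\<Sum>x\<in>f ` {..<m}. cscale (g x) x) = 0" and x: "x \<in> f ` {..<m}"
    from g have "(\<Sum>c<m. cscale (g (f c)) (f c)) = 0"
      by (subst (asm) sum.reindex[OF inj]) simp
    with * x show "g x = 0" by auto
  qed simp
  then show "cdim (cspan (f ` {..<m})) = m"
    unfolding cdim_def cspan_def
    by (simp add: cvs.dim_eq_card_independent card_image[OF inj])
qed

section \<open>The inner product, orthogonal complements and projections\<close>

lemma cinner_add_left: "cinner n (u + v) w = cinner n u w + cinner n v w"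
  and cinner_diff_left: "cinner n (u - v) w = cinner n u w - cinner n v w"
  and cinner_scale_left: "cinner n (cscale a u) w = a * cinner n u w"
  and cinner_zero_left: "cinner n 0 w = 0"
  and cinner_add_right: "cinner n w (u + v) = cinner n w u + cinner n w v"
  and cinner_scale_right: "cinner n w (cscale a u) = cnj a * cinner n w u"
  and cinner_zero_right: "cinner n w 0 = 0"
  by (simp_all add: cinner_def cscale_def sum.distrib sum_subtractf sum_distrib_left algebra_simps)

lemma cinner_commute: "cinner n u v = cnj (cinner n v u)"
  by (simp add: cinner_def mult.commute)

lemma cinner_self_eq_0: "cinner n u u = 0 \<longleftrightarrow> (\<forall>i<n. u i = 0)"
proof -
  have "cinner n u u = complex_of_real (\<Sum>i<n. (cmod (u i))\<^sup>2)"
    by (simp add: cinner_def complex_norm_square flip: of_real_power)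
  also have "\<dots> = 0 \<longleftrightarrow> (\<forall>i<n. u i = 0)"
    by (subst of_real_eq_0_iff, subst sum_nonneg_eq_0_iff) auto
  finally show ?thesis .
qed

lemma cinner_cspan_eq_0:
  assumes "\<And>u. u \<in> S \<Longrightarrow> cinner n v u = 0" "w \<in> cspan S"
  shows "cinner n v w = 0"
  using assms(2) unfolding cspan_def
proof (induction rule: cvs.span_induct_alt)
  case base
  show ?case by (rule cinner_zero_right)
next
  case (step c x y)
  then show ?case by (subst cinner_add_right, subst cinner_scale_right) (simp add: assms(1))
qed

lemma subspace_cvecs: "cvs.subspace (cvecs n)"
  by (auto simp: cvs.subspace_def cvecs_def cscale_def)

lemma subspace_orth: "cvs.subspace (orth n S)"
  using subspace_cvecs[of n]
  by (auto simp: cvs.subspace_def orth_def cinner_add_left cinner_scale_left cinner_zero_left)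

text \<open>Gram--Schmidt; a zero residual \<open>q\<close> of the new vector is covered by \<open>x / 0 = 0\<close>.\<close>

lemma orthogonal_decomposition:
  assumes "finite S"
  shows "\<exists>s\<in>cspan S. \<forall>u\<in>S. cinner n (v - s) u = 0"
  using assms
proof (induction S arbitrary: v rule: finite_induct)
  case empty
  show ?case by (auto simp: cspan_def)
next
  case (insert a S)
  obtain sa where sa: "sa \<in> cspan S" "\<And>u. u \<in> S \<Longrightarrow> cinner n (a - sa) u = 0"
    using insert.IH[of a] by blast
  obtain sv where sv: "sv \<in> cspan S" "\<And>u. u \<in> S \<Longrightarrow> cinner n (v - sv) u = 0"
    using insert.IH[of v] by blast
  define q where "q = a - sa"
  define r where "r = cinner n (v - sv) q / cinner n q q"
  define s where "s = sv + cscale r q"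
  have mono: "x \<in> cspan S \<Longrightarrow> x \<in> cspan (insert a S)" for x
    unfolding cspan_def using cvs.span_mono[of S "insert a S"] by auto
  have "s \<in> cspan (insert a S)"
    using mono[OF sa(1)] mono[OF sv(1)] cvs.span_base[of a "insert a S"] unfolding s_def q_def cspan_def
    by (intro cvs.span_add cvs.span_scale cvs.span_diff) auto
  moreover have S: "cinner n (v - s) u = 0" if "u \<in> S" for u
    using sv(2)[OF that] sa(2)[OF that]
    by (simp add: s_def q_def cinner_diff_left cinner_add_left cinner_scale_left)
  moreover have "cinner n (v - s) a = 0"
  proof -
    have "cinner n (v - s) q = 0"
    proof (cases "cinner n q q = 0")
      case True
      then have "\<forall>i<n. q i = 0" by (simp add: cinner_self_eq_0)
      then show ?thesis by (simp add: cinner_def)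
    next
      case False
      then show ?thesis
        by (simp add: s_def r_def cinner_diff_left cinner_add_left cinner_scale_left)
    qed
    moreover have "cinner n (v - s) sa = 0"
      using S sa(1) by (rule cinner_cspan_eq_0)
    moreover have "a = q + sa" by (simp add: q_def)
    ultimately show ?thesis by (metis add_0 cinner_add_right)
  qed
  ultimately show ?case by blast
qed

text \<open>Makes the definite description in \<open>proj\<close> usable. The difference of two
  candidates is orthogonal to itself, hence zero below \<open>n\<close>; membership in
  \<open>cvecs n\<close> gives the remaining coordinates, which \<open>cinner n\<close> does not
  see.\<close>

lemma proj_orth_eqI:
  assumes p: "p \<in> orth n I" and vp: "v - p \<in> cspan I"
  shows "proj n (orth n I) v = p"
  unfolding proj_def
proof (rule the_equality)
  have ortho: "cinner n (v - p) u = 0" if "u \<in> orth n I" for u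
  proof -
    have "cinner n u (v - p) = 0"
      using that by (auto simp: orth_def intro: cinner_cspan_eq_0[OF _ vp])
    then show ?thesis by (subst cinner_commute) simp
  qed
  then show "p \<in> orth n I \<and> (\<forall>u\<in>orth n I. cinner n (v - p) u = 0)"
    using p by blast
  fix p' assume p': "p' \<in> orth n I \<and> (\<forall>u\<in>orth n I. cinner n (v - p') u = 0)"
  let ?d = "p - p'"
  have d: "?d \<in> orth n I"
    using p p' by (intro cvs.subspace_diff[OF subspace_orth]) auto
  have "cinner n ?d ?d = cinner n (v - p') ?d - cinner n (v - p) ?d"
    by (simp add: cinner_diff_left)
  also have "\<dots> = 0" using p' d ortho by simp
  finally have "\<forall>i<n. ?d i = 0" by (simp add: cinner_self_eq_0)
  moreover have "\<forall>i\<ge>n. ?d i = 0" using d by (auto simp: orth_def cvecs_def)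
  ultimately have "?d i = 0" for i by (cases "i < n") auto
  then show "p' = p" by (simp add: fun_eq_iff)
qed

lemma orth_cong_cspan:
  assumes "cspan S = cspan I"
  shows "orth n S = orth n I"
proof -
  have "orth n S = orth n (cspan S)" for S
    using cinner_cspan_eq_0[of S n] by (auto simp: orth_def cspan_def cvs.span_base)
  then show ?thesis by (metis assms)
qed

text \<open>\<open>I\<close> will be a union of column spans, an infinite set; the finite generating
  set \<open>S\<close> is what Gram--Schmidt runs on.\<close>

lemma proj_orth:
  assumes "finite S" "S \<subseteq> cvecs n" "cspan I = cspan S" "v \<in> cvecs n"
  shows "proj n (orth n I) v \<in> orth n I" "v - proj n (orth n I) v \<in> cspan I"
proof -
  obtain s where s: "s \<in> cspan S" "\<And>u. u \<in> S \<Longrightarrow> cinner n (v - s) u = 0"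
    using orthogonal_decomposition[OF assms(1)] by blast
  have "s \<in> cvecs n"
    using s(1) cvs.span_minimal[OF assms(2) subspace_cvecs] by (auto simp: cspan_def)
  then have "v - s \<in> cvecs n"
    using assms(4) by (intro cvs.subspace_diff[OF subspace_cvecs])
  then have 1: "v - s \<in> orth n I"
    using s(2) orth_cong_cspan[OF assms(3)] by (auto simp: orth_def)
  moreover have 2: "v - (v - s) \<in> cspan I"
    using s(1) assms(3) by simp
  ultimately have "proj n (orth n I) v = v - s"
    by (rule proj_orth_eqI)
  with 1 2 show "proj n (orth n I) v \<in> orth n I" "v - proj n (orth n I) v \<in> cspan I"
    by simp_all
qed

text \<open>On \<open>cvecs n\<close> the projection is linear with kernel \<open>cspan I\<close>,
  so the image is spanned by the projected columns and the criterion for full dimension applies to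
  these.\<close>

lemma cdim_proj_orth_eq_iff:
  assumes S: "finite S" "S \<subseteq> cvecs n" "cspan I = cspan S" and f: "\<And>c. c < m \<Longrightarrow> f c \<in> cvecs n"
  shows "cdim (proj n (orth n I) ` cspan (f ` {..<m::nat})) = m \<longleftrightarrow>
     (\<forall>p. (\<Sum>c<m. cscale (p c) (f c)) \<in> cspan I \<longrightarrow> (\<forall>c<m. p c = 0))"
proof -
  let ?P = "proj n (orth n I)"
  have lin: "?P (\<Sum>c<m. cscale (p c) (f c)) = (\<Sum>c<m. cscale (p c) (?P (f c)))" for p
  proof (rule proj_orth_eqI)
    show "(\<Sum>c<m. cscale (p c) (?P (f c))) \<in> orth n I"
      by (intro cvs.subspace_sum[OF subspace_orth] cvs.subspace_scale[OF subspace_orth]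
            proj_orth[OF S f]) auto
    have "(\<Sum>c<m. cscale (p c) (f c)) - (\<Sum>c<m. cscale (p c) (?P (f c)))
        = (\<Sum>c<m. cscale (p c) (f c - ?P (f c)))"
      by (simp add: cvs.scale_right_diff_distrib sum_subtractf)
    also have "\<dots> \<in> cspan I"
      using proj_orth(2)[OF S f] unfolding cspan_def
      by (intro cvs.span_sum cvs.span_scale) auto
    finally show "(\<Sum>c<m. cscale (p c) (f c)) - (\<Sum>c<m. cscale (p c) (?P (f c))) \<in> cspan I" .
  qed
  have "?P ` cspan (f ` {..<m}) = cspan ((\<lambda>c. ?P (f c)) ` {..<m})"
  proof (intro set_eqI iffI)
    fix v assume "v \<in> cspan ((\<lambda>c. ?P (f c)) ` {..<m})"
    then obtain p where "v = ?P (\<Sum>c<m. cscale (p c) (f c))"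
      by (auto simp: cspan_image_iff lin)
    then show "v \<in> ?P ` cspan (f ` {..<m})"
      unfolding image_iff Bex_def cspan_image_iff by blast
  next
    fix v assume "v \<in> ?P ` cspan (f ` {..<m})"
    then show "v \<in> cspan ((\<lambda>c. ?P (f c)) ` {..<m})"
      unfolding image_iff Bex_def cspan_image_iff using lin by blast
  qed
  then have "cdim (?P ` cspan (f ` {..<m})) = m \<longleftrightarrow>
     (\<forall>p. ?P (\<Sum>c<m. cscale (p c) (f c)) = 0 \<longrightarrow> (\<forall>c<m. p c = 0))"
    by (simp add: cdim_cspan_image_eq_iff lin)
  moreover have "?P v = 0 \<longleftrightarrow> v \<in> cspan I" if "v \<in> cvecs n" for v
  proof
    assume "?P v = 0"
    then show "v \<in> cspan I" using proj_orth(2)[OF S that] by simp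
  next
    assume "v \<in> cspan I"
    then show "?P v = 0"
      by (intro proj_orth_eqI) (simp_all add: cvs.subspace_0[OF subspace_orth])
  qed
  moreover have "(\<Sum>c<m. cscale (p c) (f c)) \<in> cvecs n" for p
    using f by (intro cvs.subspace_sum[OF subspace_cvecs] cvs.subspace_scale[OF subspace_cvecs]) auto
  ultimately show ?thesis by simp
qed

section \<open>Decodability as a linear system\<close>

text \<open>A symbol assignment \<open>x k j c\<close> gives the \<open>c\<close>-th symbol from transmitter \<open>j\<close> to receiver \<open>k\<close>;
  \<open>sent m V H k j x t\<close> is what transmitter \<open>j\<close> sends at time \<open>t\<close> on behalf of receiver \<open>k\<close>.\<close>

definition sent ::
  "(nat \<Rightarrow> nat \<Rightarrow> nat) \<Rightarrow> (nat \<Rightarrow> nat \<Rightarrow> nat \<Rightarrow> (nat \<times> nat \<times> nat \<Rightarrow> complex) \<Rightarrow> nat \<Rightarrow> complex)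
     \<Rightarrow> (nat \<times> nat \<times> nat \<Rightarrow> complex) \<Rightarrow> nat \<Rightarrow> nat \<Rightarrow> (nat \<Rightarrow> nat \<Rightarrow> nat \<Rightarrow> complex) \<Rightarrow> nat \<Rightarrow> complex"
  where "sent m V H k j x t = (\<Sum>c<m k j. V k j t H c * x k j c)"

definition received ::
  "(nat \<Rightarrow> nat \<Rightarrow> nat) \<Rightarrow> (nat \<Rightarrow> nat \<Rightarrow> nat \<Rightarrow> (nat \<times> nat \<times> nat \<Rightarrow> complex) \<Rightarrow> nat \<Rightarrow> complex)
     \<Rightarrow> (nat \<times> nat \<times> nat \<Rightarrow> complex) \<Rightarrow> nat \<Rightarrow> (nat \<Rightarrow> nat \<Rightarrow> nat \<Rightarrow> complex) \<Rightarrow> nat \<Rightarrow> complex"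
  where "received m V H k x t =
    (\<Sum>j\<in>{1,2}. H (t,k,j) * (sent m V H 1 j x t + sent m V H 2 j x t))"

lemma received_split:
  assumes "k \<in> {1,2}" "j \<in> {1,2}"
  shows "received m V H r x t =
    H (t,r,j) * (sent m V H k j x t + sent m V H (3-k) j x t)
    + H (t,r,3-j) * (sent m V H k (3-j) x t + sent m V H (3-k) (3-j) x t)"
  using assms by (auto simp: received_def algebra_simps)

text \<open>A combination of the wanted columns lies in the interference span exactly when the other
  three symbol vectors can be chosen to cancel it at receiver \<open>k\<close>.\<close>

lemma cdim_proj_GVspan_eq_iff:
  fixes n m V H
  assumes k: "k \<in> {1,2}" and j: "j \<in> {1,2}"
  defines "I \<equiv> GVspan n m V H k j (3-k) \<union> GVspan n m V H k (3-j) k \<union> GVspan n m V H k (3-j) (3-k)"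
  shows "cdim (proj n (orth n I) ` GVspan n m V H k j k) = m k j \<longleftrightarrow>
    (\<forall>x. (\<forall>t<n. received m V H k x t = 0) \<longrightarrow> (\<forall>c<m k j. x k j c = 0))"
proof -
  define g where "g k2 j2 c = (\<lambda>t. if t < n then H (t,k,j2) * V k2 j2 t H c else 0)" for k2 j2 c
  have G: "GVspan n m V H k j2 k2 = cspan (g k2 j2 ` {..<m k2 j2})" for j2 k2
    unfolding GVspan_def colspan_def g_def ..
  have g_cvecs: "g k2 j2 c \<in> cvecs n" for k2 j2 c
    by (simp add: g_def cvecs_def)
  let ?S1 = "g (3-k) j ` {..<m (3-k) j}" and ?S2 = "g k (3-j) ` {..<m k (3-j)}"
    and ?S3 = "g (3-k) (3-j) ` {..<m (3-k) (3-j)}"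
  define S where "S = ?S1 \<union> ?S2 \<union> ?S3"
  have S: "finite S" "S \<subseteq> cvecs n"
    using g_cvecs by (auto simp: S_def)
  have IS: "cspan I = cspan S"
    unfolding I_def S_def G cspan_def by (simp add: cvs.span_Un cvs.span_span)
  have comb: "(\<Sum>c<l. cscale (p c) (g k2 j2 c)) t
      = (if t < n then H (t,k,j2) * (\<Sum>c<l. V k2 j2 t H c * p c) else 0)" for l p k2 j2 t
    by (simp add: sum_cscale_apply g_def sum_distrib_left mult_ac)
  have mem: "v \<in> cspan I \<longleftrightarrow> (\<exists>p1 p2 p3. v = (\<Sum>c<m (3-k) j. cscale (p1 c) (g (3-k) j c))
      + (\<Sum>c<m k (3-j). cscale (p2 c) (g k (3-j) c))
      + (\<Sum>c<m (3-k) (3-j). cscale (p3 c) (g (3-k) (3-j) c)))" for v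
    unfolding IS S_def
    unfolding cspan_def cvs.span_Un cspan_image_iff[unfolded cspan_def] mem_Collect_eq
    by (safe; blast)
  have "(\<forall>p. (\<Sum>c<m k j. cscale (p c) (g k j c)) \<in> cspan I \<longrightarrow> (\<forall>c<m k j. p c = 0)) \<longleftrightarrow>
    (\<forall>x. (\<forall>t<n. received m V H k x t = 0) \<longrightarrow> (\<forall>c<m k j. x k j c = 0))"
    (is "?L \<longleftrightarrow> ?R")
  proof
    assume L: ?L
    show ?R
    proof (intro allI impI)
      fix x c assume x: "\<forall>t<n. received m V H k x t = 0" and c: "c < m k j"
      have "(\<Sum>c<m k j. cscale (x k j c) (g k j c))
        = (\<Sum>c<m (3-k) j. cscale (- x (3-k) j c) (g (3-k) j c))
        + (\<Sum>c<m k (3-j). cscale (- x k (3-j) c) (g k (3-j) c))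
        + (\<Sum>c<m (3-k) (3-j). cscale (- x (3-k) (3-j) c) (g (3-k) (3-j) c))"
      proof (rule ext)
        fix t
        have "t < n \<Longrightarrow> H (t,k,j) * (sent m V H k j x t + sent m V H (3-k) j x t)
          + H (t,k,3-j) * (sent m V H k (3-j) x t + sent m V H (3-k) (3-j) x t) = 0"
          using x received_split[OF k j, of m V H k x t] by simp
        then show "(\<Sum>c<m k j. cscale (x k j c) (g k j c)) t
          = ((\<Sum>c<m (3-k) j. cscale (- x (3-k) j c) (g (3-k) j c))
          + (\<Sum>c<m k (3-j). cscale (- x k (3-j) c) (g k (3-j) c))
          + (\<Sum>c<m (3-k) (3-j). cscale (- x (3-k) (3-j) c) (g (3-k) (3-j) c))) t"
          unfolding plus_fun_apply comb sent_def
          by (cases "t < n"; simp add: sum_negf; algebra)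
      qed
      then have "(\<Sum>c<m k j. cscale (x k j c) (g k j c)) \<in> cspan I"
        unfolding mem by (intro exI)
      with L c show "x k j c = 0" by blast
    qed
  next
    assume R: ?R
    show ?L
    proof (intro allI impI)
      fix p c assume p: "(\<Sum>c<m k j. cscale (p c) (g k j c)) \<in> cspan I" and c: "c < m k j"
      then obtain p1 p2 p3 where eq: "(\<Sum>c<m k j. cscale (p c) (g k j c))
        = (\<Sum>c<m (3-k) j. cscale (p1 c) (g (3-k) j c))
        + (\<Sum>c<m k (3-j). cscale (p2 c) (g k (3-j) c))
        + (\<Sum>c<m (3-k) (3-j). cscale (p3 c) (g (3-k) (3-j) c))"
        unfolding mem by (elim exE)
      \<comment> \<open>The interfering symbols carry a minus sign so that everything cancels at the
        receiver.\<close>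
      define x where "x a b = (if a = k \<and> b = j then p else if b = j then - p1
        else if a = k then - p2 else - p3)" for a b :: nat
      have [simp]: "3 - k \<noteq> k" "3 - j \<noteq> j" using k j by auto
      have "received m V H k x t = 0" if t: "t < n" for t
        using fun_cong[OF eq, of t] t
        unfolding plus_fun_apply comb received_split[OF k j] sent_def x_def
        by (simp add: sum_negf algebra_simps)
      with R c have "x k j c = 0" by blast
      then show "p c = 0" by (simp add: x_def)
    qed
  qed
  then show ?thesis
    unfolding G using cdim_proj_orth_eq_iff[OF S IS, of "m k j" "g k j"] g_cvecs by simp
qed

text \<open>Symbols annihilated by their precoder are also received as zero; in this way the rank
  condition on \<open>V\<close> is absorbed into the condition on reception.\<close>

lemma decodable_iff:
  "decodable n m V H \<longleftrightarrow> (\<forall>k\<in>{1,2}. \<forall>x. (\<forall>t<n. received m V H k x t = 0) \<longrightarrow>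
     (\<forall>j\<in>{1,2}. \<forall>c<m k j. x k j c = 0))"
proof -
  have indep: "cdim (colspan n (m k j) (\<lambda>t c. V k j t H c)) = m k j"
    if kj: "k \<in> {1,2}" "j \<in> {1,2}"
      and dec: "\<forall>x. (\<forall>t<n. received m V H k x t = 0) \<longrightarrow> (\<forall>c<m k j. x k j c = 0)" for k j
    unfolding colspan_def cdim_cspan_image_eq_iff
  proof (intro allI impI)
    fix p c
    assume z: "(\<Sum>c<m k j. cscale (p c) (\<lambda>t. if t < n then V k j t H c else 0)) = 0" and c: "c < m k j"
    define x where "x a b = (if a = k \<and> b = j then p else 0)" for a b :: nat
    have [simp]: "3 - k \<noteq> k" "3 - j \<noteq> j" using kj by auto
    have "received m V H k x t = 0" if t: "t < n" for t
      using fun_cong[OF z, of t] t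
      unfolding sum_cscale_apply received_split[OF kj] sent_def x_def
      by (simp add: mult.commute)
    with dec c have "x k j c = 0" by blast
    then show "p c = 0" by (simp add: x_def)
  qed
  have "decodable n m V H \<longleftrightarrow> (\<forall>k\<in>{1,2}. \<forall>j\<in>{1,2}.
      \<forall>x. (\<forall>t<n. received m V H k x t = 0) \<longrightarrow> (\<forall>c<m k j. x k j c = 0))"
    unfolding decodable_def Let_def
  proof (intro ball_cong refl)
    fix k j :: nat assume kj: "k \<in> {1,2}" "j \<in> {1,2}"
    show "(cdim (proj n (orth n (GVspan n m V H k j (3 - k) \<union> GVspan n m V H k (3 - j) k
            \<union> GVspan n m V H k (3 - j) (3 - k))) ` GVspan n m V H k j k) = m k j
          \<and> cdim (colspan n (m k j) (\<lambda>t c. V k j t H c)) = m k j) \<longleftrightarrow>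
        (\<forall>x. (\<forall>t<n. received m V H k x t = 0) \<longrightarrow> (\<forall>c<m k j. x k j c = 0))"
      using indep[OF kj] cdim_proj_GVspan_eq_iff[OF kj, of n m V H] by satx
  qed
  then show ?thesis by blast
qed

text \<open>Gaussian elimination of one equation and one unknown at a time. Arbitrary index sets are
  allowed because the converse uses pairs and disjoint sums as unknowns.\<close>

lemma underdetermined_system_nontrivial:
  fixes A :: "'e \<Rightarrow> 'u \<Rightarrow> 'a::field"
  assumes "finite E" "finite U" "card E < card U"
  shows "\<exists>x. (\<exists>u\<in>U. x u \<noteq> 0) \<and> (\<forall>e\<in>E. (\<Sum>u\<in>U. A e u * x u) = 0)"
  using assms
proof (induction E arbitrary: U A rule: finite_induct)
  case empty
  then have "U \<noteq> {}" by auto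
  then show ?case by (intro exI[of _ "\<lambda>_. 1"]) auto
next
  case (insert e E)
  show ?case
  proof (cases "\<forall>u\<in>U. A e u = 0")
    case True
    obtain x where "\<exists>u\<in>U. x u \<noteq> 0" "\<forall>e\<in>E. (\<Sum>u\<in>U. A e u * x u) = 0"
      using insert.IH[of U A] insert.prems insert.hyps by auto
    with True show ?thesis by (intro exI[of _ x]) auto
  next
    case False
    then obtain u0 where u0: "u0 \<in> U" "A e u0 \<noteq> 0" by blast
    define W where "W = U - {u0}"
    \<comment> \<open>The other equations after equation \<open>e\<close> has been solved for
      \<open>u0\<close>.\<close>
    define B where "B e' u = A e' u - A e' u0 * A e u / A e u0" for e' u
    have "finite W" "card E < card W"
      using insert.prems insert.hyps u0 by (auto simp: W_def)
    then obtain y where y: "\<exists>u\<in>W. y u \<noteq> 0" "\<forall>e'\<in>E. (\<Sum>u\<in>W. B e' u * y u) = 0"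
      using insert.IH[of W B] by blast
    define s where "s = (\<Sum>u\<in>W. A e u * y u)"
    define x where "x = y(u0 := - s / A e u0)"
    have sum_x: "(\<Sum>u\<in>U. A e' u * x u) = (\<Sum>u\<in>W. A e' u * y u) - A e' u0 * s / A e u0" for e'
    proof -
      have "(\<Sum>u\<in>U. A e' u * x u) = A e' u0 * x u0 + (\<Sum>u\<in>W. A e' u * x u)"
        unfolding W_def using insert.prems u0 by (intro sum.remove) auto
      also have "(\<Sum>u\<in>W. A e' u * x u) = (\<Sum>u\<in>W. A e' u * y u)"
        by (intro sum.cong) (auto simp: x_def W_def)
      finally show ?thesis by (simp add: x_def)
    qed
    have "(\<Sum>u\<in>U. A e' u * x u) = 0" if "e' \<in> insert e E" for e'
    proof (cases "e' = e")
      case True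
      then show ?thesis using u0 by (simp add: sum_x flip: s_def)
    next
      case False
      then have "(\<Sum>u\<in>W. B e' u * y u) = 0" using y that by auto
      then show ?thesis
        unfolding sum_x
        by (simp add: s_def B_def sum_subtractf right_diff_distrib sum_distrib_left
            sum_divide_distrib mult_ac)
    qed
    moreover have "\<exists>u\<in>U. x u \<noteq> 0"
      using y(1) by (auto simp: x_def W_def)
    ultimately show ?thesis by blast
  qed
qed

section \<open>Almost sure genericity of the channel\<close>

locale channel_law = prob_space \<mu> for \<mu> :: "complex measure" +
  assumes sets_eq_borel: "sets \<mu> = sets borel"
    and absolutely_continuous: "absolutely_continuous lborel \<mu>"
begin

lemma emeasure_singleton [simp]: "emeasure \<mu> {z} = 0"
proof -
  have "{z} \<in> null_sets lborel" by (intro null_setsI) auto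
  then show ?thesis
    using absolutely_continuous by (auto simp: absolutely_continuous_def)
qed

lemma finite_chan_idx: "finite (chan_idx n)"
  by (simp add: chan_idx_def)

lemma measurable_coord:
  assumes "i \<in> chan_idx n"
  shows "(\<lambda>H. H i) \<in> borel_measurable (chan_space \<mu> n)"
  using measurable_component_singleton[OF assms, of "\<lambda>_. \<mu>"]
  by (simp add: chan_space_def cong: measurable_cong_sets[OF refl sets_eq_borel])

text \<open>Fubini: integrating first over coordinate \<open>i\<close>, with \<open>f H\<close>
  fixed, leaves the measure of the single point \<open>f H\<close>, which is zero.\<close>

lemma AE_coord_neq:
  assumes i: "i \<in> chan_idx n" and f: "f \<in> borel_measurable (chan_space \<mu> n)"
    and indep: "\<And>H y. f (H(i := y)) = f H"
  shows "AE H in chan_space \<mu> n. H i \<noteq> f H"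
proof -
  interpret P: product_prob_space "\<lambda>_. \<mu>" by unfold_locales
  define I where "I = chan_idx n - {i}"
  have I: "finite I" "i \<notin> I" "insert i I = chan_idx n"
    using i finite_chan_idx by (auto simp: I_def)
  define N where "N = {H \<in> space (chan_space \<mu> n). H i = f H}"
  have N: "N \<in> sets (chan_space \<mu> n)"
    unfolding N_def using measurable_coord[OF i] f by measurable
  then have ind: "indicator N \<in> borel_measurable (Pi\<^sub>M (insert i I) (\<lambda>_. \<mu>))"
    using I(3) by (simp add: chan_space_def)
  have "emeasure (chan_space \<mu> n) N = (\<integral>\<^sup>+ H. indicator N H \<partial>chan_space \<mu> n)"
    using N by simp
  also have "\<dots> = (\<integral>\<^sup>+ H. (\<integral>\<^sup>+ y. indicator N (H(i := y)) \<partial>\<mu>) \<partial>Pi\<^sub>M I (\<lambda>_. \<mu>))"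
    using P.product_nn_integral_insert[OF I(1,2) ind] I(3) by (simp add: chan_space_def)
  also have "\<dots> \<le> (\<integral>\<^sup>+ H. (\<integral>\<^sup>+ y. indicator {f H} y \<partial>\<mu>) \<partial>Pi\<^sub>M I (\<lambda>_. \<mu>))"
    by (intro nn_integral_mono) (auto simp: N_def indep split: split_indicator)
  also have "\<dots> = 0"
    by (simp add: sets_eq_borel)
  finally have "emeasure (chan_space \<mu> n) N = 0" by simp
  then show ?thesis
    using N by (intro AE_I'[of N]) (auto simp: N_def)
qed

text \<open>If \<open>f H\<close> were nonzero, the equation would prescribe \<open>H i\<close> by a
  quotient that does not depend on \<open>H i\<close>, a null event. Then \<open>g H\<close>
  vanishes because \<open>H i'\<close> is almost surely nonzero.\<close>

lemma AE_coord_combination: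
  assumes i: "i \<in> chan_idx n" "i' \<in> chan_idx n" "i \<noteq> i'"
    and f: "f \<in> borel_measurable (chan_space \<mu> n)" "g \<in> borel_measurable (chan_space \<mu> n)"
    and indep: "\<And>H y. f (H(i := y)) = f H" "\<And>H y. g (H(i := y)) = g H"
  shows "AE H in chan_space \<mu> n. H i * f H + H i' * g H = 0 \<longrightarrow> f H = 0 \<and> g H = 0"
proof -
  have "AE H in chan_space \<mu> n. H i \<noteq> - (H i' * g H / f H)"
    using f measurable_coord[OF i(2)] i(3) by (intro AE_coord_neq i) (auto simp: indep)
  moreover have "AE H in chan_space \<mu> n. H i' \<noteq> 0"
    using AE_coord_neq[OF i(2), of "\<lambda>_. 0"] by simp
  ultimately show ?thesis
  proof eventually_elim
    case (elim H)
    show ?case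
    proof (cases "f H = 0")
      case False
      with elim(1) show ?thesis by (auto simp: field_simps eq_neg_iff_add_eq_0)
    qed (use elim in auto)
  qed
qed

end

section \<open>Causal functions and measurable generators of kernels\<close>

text \<open>With this offset precoders at time \<open>t\<close> are \<open>causal t\<close>, while
  the coefficients received at time \<open>t\<close> are \<open>causal (Suc t)\<close>.\<close>

definition causal :: "nat \<Rightarrow> ((nat \<times> nat \<times> nat \<Rightarrow> complex) \<Rightarrow> 'a) \<Rightarrow> bool" where
  "causal t f \<longleftrightarrow> (\<forall>H H'. (\<forall>i. fst i < t \<longrightarrow> H i = H' i) \<longrightarrow> f H = f H')"

lemma causal_mono: "causal s f \<Longrightarrow> s \<le> t \<Longrightarrow> causal t f"
  unfolding causal_def by (meson order_less_le_trans)

lemma causalD: "causal t f \<Longrightarrow> (\<And>i. fst i < t \<Longrightarrow> H i = H' i) \<Longrightarrow> f H = f H'"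
  unfolding causal_def by blast

lemma causal_upd: "causal t f \<Longrightarrow> t \<le> fst i \<Longrightarrow> f (H(i := y)) = f H"
  by (erule causalD) auto

text \<open>\<open>F\<close> generates the subspace annihilated by the first \<open>t\<close> rows, measurably and causally.
  Generation is expressed dually: a functional vanishing on \<open>F\<close> vanishes on the subspace.\<close>

definition kernel_generators ::
  "(nat \<times> nat \<times> nat \<Rightarrow> complex) measure \<Rightarrow> 'u set \<Rightarrow> (nat \<Rightarrow> (nat \<times> nat \<times> nat \<Rightarrow> complex) \<Rightarrow> 'u \<Rightarrow> complex)
     \<Rightarrow> nat \<Rightarrow> ((nat \<times> nat \<times> nat \<Rightarrow> complex) \<Rightarrow> 'u \<Rightarrow> complex) set \<Rightarrow> bool" where
  "kernel_generators M U \<rho> t F \<longleftrightarrow> finite F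
    \<and> (\<forall>w\<in>F. \<forall>u\<in>U. (\<lambda>H. w H u) \<in> borel_measurable M \<and> causal t (\<lambda>H. w H u))
    \<and> (\<forall>H. \<forall>w\<in>F. \<forall>s<t. (\<Sum>u\<in>U. \<rho> s H u * w H u) = 0)
    \<and> (\<forall>H \<psi> z. (\<forall>w\<in>F. (\<Sum>u\<in>U. \<psi> u * w H u) = 0) \<longrightarrow>
          (\<forall>s<t. (\<Sum>u\<in>U. \<rho> s H u * z u) = 0) \<longrightarrow> (\<Sum>u\<in>U. \<psi> u * z u) = 0)"

text \<open>The generators of the next subspace are the old ones killed by the new row together with all
  two-by-two eliminations; this avoids choosing a pivot measurably.\<close>

lemma kernel_generators_exist:
  fixes \<rho> :: "nat \<Rightarrow> (nat \<times> nat \<times> nat \<Rightarrow> complex) \<Rightarrow> 'u \<Rightarrow> complex"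
  assumes U: "finite U"
    and \<rho>: "\<And>s u. s < t \<Longrightarrow> u \<in> U \<Longrightarrow> (\<lambda>H. \<rho> s H u) \<in> borel_measurable M \<and> causal (Suc s) (\<lambda>H. \<rho> s H u)"
  shows "\<exists>F. kernel_generators M U \<rho> t F"
  using \<rho>
proof (induction t)
  case 0
  define F :: "((nat \<times> nat \<times> nat \<Rightarrow> complex) \<Rightarrow> 'u \<Rightarrow> complex) set"
    where "F = (\<lambda>v H u. if u = v then 1 else 0) ` U"
  have "\<psi> u = 0" if "\<forall>w\<in>F. (\<Sum>u\<in>U. \<psi> u * w H u) = 0" "u \<in> U"
    for H :: "nat \<times> nat \<times> nat \<Rightarrow> complex" and \<psi> u
  proof -
    have "(\<lambda>H v. if v = u then 1 else 0) \<in> F"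
      using that(2) by (auto simp: F_def)
    then have "(\<Sum>v\<in>U. \<psi> v * (if v = u then 1 else 0)) = 0" using that(1) by auto
    then show ?thesis using U that(2) by (simp add: if_distrib sum.delta cong: if_cong)
  qed
  then have "(\<Sum>u\<in>U. \<psi> u * z u) = 0" if "\<forall>w\<in>F. (\<Sum>u\<in>U. \<psi> u * w H u) = 0"
    for H :: "nat \<times> nat \<times> nat \<Rightarrow> complex" and \<psi> z
    using that by (intro sum.neutral) auto
  moreover have "finite F" "\<forall>w\<in>F. \<forall>u\<in>U. (\<lambda>H. w H u) \<in> borel_measurable M \<and> causal 0 (\<lambda>H. w H u)"
    using U by (auto simp: F_def causal_def)
  ultimately show ?case
    unfolding kernel_generators_def by (intro exI[of _ F]) auto
next
  case (Suc t)
  then obtain F where gen: "kernel_generators M U \<rho> t F"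
    by (metis less_Suc_eq)
  have F: "finite F"
    "\<And>w u. w \<in> F \<Longrightarrow> u \<in> U \<Longrightarrow> (\<lambda>H. w H u) \<in> borel_measurable M \<and> causal t (\<lambda>H. w H u)"
    "\<And>H w s. w \<in> F \<Longrightarrow> s < t \<Longrightarrow> (\<Sum>u\<in>U. \<rho> s H u * w H u) = 0"
    "\<And>H \<psi> z. (\<forall>w\<in>F. (\<Sum>u\<in>U. \<psi> u * w H u) = 0) \<Longrightarrow>
          (\<forall>s<t. (\<Sum>u\<in>U. \<rho> s H u * z u) = 0) \<Longrightarrow> (\<Sum>u\<in>U. \<psi> u * z u) = 0"
    using gen unfolding kernel_generators_def by blast+
  define \<phi> where "\<phi> H w = (\<Sum>u\<in>U. \<rho> t H u * w H u)" for H and w :: "_ \<Rightarrow> 'u \<Rightarrow> complex"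
  define A where "A w = (\<lambda>H u. if \<phi> H w = 0 then w H u else 0)" for w
  define B where "B w w' = (\<lambda>H u. \<phi> H w * w' H u - \<phi> H w' * w H u)" for w w'
  define G where "G = A ` F \<union> (\<lambda>(w,w'). B w w') ` (F \<times> F)"
  have \<phi>: "(\<lambda>H. \<phi> H w) \<in> borel_measurable M" "causal (Suc t) (\<lambda>H. \<phi> H w)" if "w \<in> F" for w
  proof -
    show "(\<lambda>H. \<phi> H w) \<in> borel_measurable M"
      unfolding \<phi>_def using F(2)[OF that] Suc.prems[of t]
      by (intro borel_measurable_sum borel_measurable_times) auto
    show "causal (Suc t) (\<lambda>H. \<phi> H w)"
      unfolding causal_def \<phi>_def
    proof (intro allI impI sum.cong refl arg_cong2[of _ _ _ _ "(*)"])
      fix H H' :: "nat \<times> nat \<times> nat \<Rightarrow> complex" and u assume "\<forall>i. fst i < Suc t \<longrightarrow> H i = H' i" "u \<in> U"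
      then show "\<rho> t H u = \<rho> t H' u" "w H u = w H' u"
        using causalD[of "Suc t" "\<lambda>H. \<rho> t H u" H H'] causalD[of t "\<lambda>H. w H u" H H']
          Suc.prems[of t u] F(2)[OF that] by auto
    qed
  qed
  have wc: "causal (Suc t) (\<lambda>H. w H u)" if "w \<in> F" "u \<in> U" for w u
    using F(2)[OF that] by (blast intro: causal_mono le_SucI)
  have "finite G" using F(1) by (simp add: G_def)
  moreover have "(\<lambda>H. w H u) \<in> borel_measurable M \<and> causal (Suc t) (\<lambda>H. w H u)"
    if "w \<in> G" "u \<in> U" for w u
  proof -
    have "(\<lambda>H. A v H u) \<in> borel_measurable M \<and> causal (Suc t) (\<lambda>H. A v H u)" if v: "v \<in> F" for v
    proof
      have [measurable]: "(\<lambda>H. v H u) \<in> borel_measurable M" "(\<lambda>H. \<phi> H v) \<in> borel_measurable M"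
        using \<phi>(1)[OF v] F(2)[OF v \<open>u \<in> U\<close>] by auto
      show "(\<lambda>H. A v H u) \<in> borel_measurable M"
        unfolding A_def by measurable
      show "causal (Suc t) (\<lambda>H. A v H u)"
        using \<phi>(2)[OF v] wc[OF v \<open>u \<in> U\<close>] unfolding causal_def A_def by metis
    qed
    moreover have "(\<lambda>H. B v v' H u) \<in> borel_measurable M \<and> causal (Suc t) (\<lambda>H. B v v' H u)"
      if v: "v \<in> F" "v' \<in> F" for v v'
    proof
      show "(\<lambda>H. B v v' H u) \<in> borel_measurable M"
        unfolding B_def
        using \<phi>(1)[OF v(1)] \<phi>(1)[OF v(2)] F(2)[OF v(1) \<open>u \<in> U\<close>] F(2)[OF v(2) \<open>u \<in> U\<close>] by auto
      show "causal (Suc t) (\<lambda>H. B v v' H u)"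
        using \<phi>(2)[OF v(1)] \<phi>(2)[OF v(2)] wc[OF v(1) \<open>u \<in> U\<close>] wc[OF v(2) \<open>u \<in> U\<close>]
        unfolding causal_def B_def by metis
    qed
    ultimately show ?thesis using \<open>w \<in> G\<close> by (auto simp: G_def)
  qed
  moreover have A_sum: "(\<Sum>u\<in>U. \<psi> u * A w H u) = (if \<phi> H w = 0 then \<Sum>u\<in>U. \<psi> u * w H u else 0)"
    for \<psi> w H by (simp add: A_def)
  have B_sum: "(\<Sum>u\<in>U. \<psi> u * B w w' H u)
      = \<phi> H w * (\<Sum>u\<in>U. \<psi> u * w' H u) - \<phi> H w' * (\<Sum>u\<in>U. \<psi> u * w H u)" for \<psi> w w' H
    by (simp add: B_def right_diff_distrib sum_subtractf sum_distrib_left mult_ac)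
  have "(\<Sum>u\<in>U. \<rho> s H u * w H u) = 0" if "w \<in> G" "s < Suc t" for H w s
  proof (cases "s = t")
    case True
    then show ?thesis
      using that by (auto simp: G_def A_sum B_sum \<phi>_def)
  next
    case False
    then show ?thesis
      using that F(3)[of _ s H] by (auto simp: G_def A_sum B_sum)
  qed
  moreover have "(\<Sum>u\<in>U. \<psi> u * z u) = 0"
    if kill: "\<forall>w\<in>G. (\<Sum>u\<in>U. \<psi> u * w H u) = 0" and z: "\<forall>s<Suc t. (\<Sum>u\<in>U. \<rho> s H u * z u) = 0"
    for H \<psi> z
  proof (cases "\<forall>w\<in>F. \<phi> H w = 0")
    case True
    have "(\<Sum>u\<in>U. \<psi> u * w H u) = 0" if "w \<in> F" for w
      using kill that True A_sum[of \<psi> w H] by (auto simp: G_def)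
    then show ?thesis using F(4)[of \<psi> H z] z by simp
  next
    case False
    then obtain w0 where w0: "w0 \<in> F" "\<phi> H w0 \<noteq> 0" by blast
    define c where "c = (\<Sum>u\<in>U. \<psi> u * w0 H u)"
    \<comment> \<open>A multiple of the new row is subtracted so that the functional kills
      \<open>w0\<close>; on any \<open>w\<close> its value is that of \<open>\<psi>\<close> on
      \<open>B w0 w\<close>. On \<open>z\<close> the new row is zero, so only the nonzero factor
      \<open>\<phi> H w0\<close> remains.\<close>
    define \<psi>' where "\<psi>' u = \<phi> H w0 * \<psi> u - c * \<rho> t H u" for u
    have \<psi>'_sum: "(\<Sum>u\<in>U. \<psi>' u * y u) = \<phi> H w0 * (\<Sum>u\<in>U. \<psi> u * y u) - c * (\<Sum>u\<in>U. \<rho> t H u * y u)" for y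
      by (simp add: \<psi>'_def left_diff_distrib sum_subtractf sum_distrib_left mult.assoc)
    have "(\<Sum>u\<in>U. \<psi>' u * w H u) = 0" if "w \<in> F" for w
    proof -
      have "B w0 w \<in> G" using that w0 by (auto simp: G_def)
      then have "(\<Sum>u\<in>U. \<psi> u * B w0 w H u) = 0" using kill by blast
      then show ?thesis
        unfolding \<psi>'_sum B_sum \<phi>_def[symmetric] c_def by (simp add: mult.commute)
    qed
    then have "(\<Sum>u\<in>U. \<psi>' u * z u) = 0" using F(4)[of \<psi>' H z] z by simp
    then show ?thesis using w0 z by (simp add: \<psi>'_sum)
  qed
  ultimately show ?case unfolding kernel_generators_def by (intro exI[of _ G] conjI) blast+
qed

section \<open>The symbols of one receiver as a single vector\<close>

definition syms :: "(nat \<Rightarrow> nat \<Rightarrow> nat) \<Rightarrow> nat \<Rightarrow> (nat \<times> nat) set" where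
  "syms m k = (SIGMA j:{1,2}. {..<m k j})"

text \<open>Symbols for receiver \<open>k\<close> are indexed by \<open>u = (j, c)\<close>.  \<open>coef V H k q t u\<close> is the coefficient of such a
  symbol in what receiver \<open>q\<close> observes at time \<open>t\<close>; \<open>leg\<close> is the part of it due to transmitter \<open>j\<close>, without
  the channel gain.\<close>

definition coef ::
  "(nat \<Rightarrow> nat \<Rightarrow> nat \<Rightarrow> (nat \<times> nat \<times> nat \<Rightarrow> complex) \<Rightarrow> nat \<Rightarrow> complex)
     \<Rightarrow> (nat \<times> nat \<times> nat \<Rightarrow> complex) \<Rightarrow> nat \<Rightarrow> nat \<Rightarrow> nat \<Rightarrow> nat \<times> nat \<Rightarrow> complex" where
  "coef V H k q t u = H (t, q, fst u) * V k (fst u) t H (snd u)"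

definition leg ::
  "(nat \<Rightarrow> nat \<Rightarrow> nat \<Rightarrow> (nat \<times> nat \<times> nat \<Rightarrow> complex) \<Rightarrow> nat \<Rightarrow> complex)
     \<Rightarrow> (nat \<times> nat \<times> nat \<Rightarrow> complex) \<Rightarrow> nat \<Rightarrow> nat \<Rightarrow> nat \<Rightarrow> nat \<times> nat \<Rightarrow> complex" where
  "leg V H k j t u = (if fst u = j then V k j t H (snd u) else 0)"

lemma finite_syms: "finite (syms m k)"
  and card_syms: "card (syms m k) = m k 1 + m k 2"
  and fst_syms: "u \<in> syms m k \<Longrightarrow> fst u = 1 \<or> fst u = 2"
  by (auto simp: syms_def)

lemma coef_sum:
  "(\<Sum>u\<in>syms m k. coef V H k q t u * z u) =
     H (t,q,1) * (\<Sum>u\<in>syms m k. leg V H k 1 t u * z u)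
   + H (t,q,2) * (\<Sum>u\<in>syms m k. leg V H k 2 t u * z u)"
  unfolding sum_distrib_left sum.distrib[symmetric]
  by (intro sum.cong) (auto simp: coef_def leg_def dest!: fst_syms)

lemma received_eq:
  assumes "k \<in> {1,2}"
  shows "received m V H q x t =
     (\<Sum>u\<in>syms m k. coef V H k q t u * x k (fst u) (snd u))
   + (\<Sum>u\<in>syms m (3-k). coef V H (3-k) q t u * x (3-k) (fst u) (snd u))"
proof -
  have "(\<Sum>u\<in>syms m k. coef V H k q t u * x k (fst u) (snd u))
      = (\<Sum>j\<in>{1,2}. H (t,q,j) * sent m V H k j x t)" for k
    unfolding syms_def coef_def sent_def sum_distrib_left
    by (subst sum.Sigma) (auto simp: case_prod_beta mult.assoc)
  then show ?thesis
    using assms by (auto simp: received_def algebra_simps)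
qed

context channel_law begin

text \<open>The generators of the kernel of the earlier rows, and the two legs at time
  \<open>t\<close>, depend on the past, whereas the gains at time \<open>t\<close> are fresh. If
  these combine the legs of a generator to zero, both legs vanish almost surely. Finitely many
  generators reduce the statement for all \<open>z\<close> to finitely many null events.\<close>

lemma AE_silent_row_legs_vanish:
  assumes V: "delayed_csit \<mu> n V" and k: "k \<in> {1,2}" and q: "q \<in> {1,2}" and t: "t < n"
  shows "AE H in chan_space \<mu> n.
    (\<forall>z. (\<forall>s<t. (\<Sum>u\<in>syms m k. coef V H k q s u * z u) = 0) \<longrightarrow>
        (\<Sum>u\<in>syms m k. coef V H k q t u * z u) = 0) \<longrightarrow>
    (\<forall>z. (\<forall>s<t. (\<Sum>u\<in>syms m k. coef V H k q s u * z u) = 0) \<longrightarrow>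
        (\<forall>j\<in>{1,2}. (\<Sum>u\<in>syms m k. leg V H k j t u * z u) = 0))"
proof -
  let ?U = "syms m k" and ?M = "chan_space \<mu> n"
  have V_meas: "(\<lambda>H. V k j s H c) \<in> borel_measurable ?M"
    and V_causal: "causal s (\<lambda>H. V k j s H c)" if "s < n" "j \<in> {1,2}" for s j c
  proof -
    show "(\<lambda>H. V k j s H c) \<in> borel_measurable ?M"
      using V k that unfolding delayed_csit_def by blast
    have "V k j s H c = V k j s H' c"
      if "\<forall>i. fst i < s \<longrightarrow> H i = H' i" for H H'
    proof -
      have "\<forall>s'<s. \<forall>k'\<in>{1,2}. \<forall>j'\<in>{1,2}. H (s',k',j') = H' (s',k',j')" using that by simp
      then show ?thesis
        using V k \<open>s < n\<close> \<open>j \<in> {1,2}\<close> unfolding delayed_csit_def by blast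
    qed
    then show "causal s (\<lambda>H. V k j s H c)" by (simp add: causal_def)
  qed
  have rows: "(\<lambda>H. coef V H k q s u) \<in> borel_measurable ?M \<and> causal (Suc s) (\<lambda>H. coef V H k q s u)"
    if s: "s < t" and u: "u \<in> ?U" for s u
  proof
    have sn: "s < n" and j: "fst u \<in> {1,2}" using s t fst_syms[OF u] by auto
    then have "(s, q, fst u) \<in> chan_idx n" using q by (auto simp: chan_idx_def)
    then show "(\<lambda>H. coef V H k q s u) \<in> borel_measurable ?M"
      unfolding coef_def using V_meas[OF sn j] measurable_coord by (intro borel_measurable_times) auto
    show "causal (Suc s) (\<lambda>H. coef V H k q s u)"
      using V_causal[OF sn j, of "snd u"] unfolding causal_def coef_def by (metis fst_conv less_Suc_eq)
  qed
  obtain F where gen: "kernel_generators ?M ?U (\<lambda>s H. coef V H k q s) t F"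
    using kernel_generators_exist[of ?U t "\<lambda>s H. coef V H k q s" ?M, OF finite_syms rows] by blast
  have F: "finite F"
    "\<And>w u. w \<in> F \<Longrightarrow> u \<in> ?U \<Longrightarrow> (\<lambda>H. w H u) \<in> borel_measurable ?M \<and> causal t (\<lambda>H. w H u)"
    "\<And>H w s. w \<in> F \<Longrightarrow> s < t \<Longrightarrow> (\<Sum>u\<in>?U. coef V H k q s u * w H u) = 0"
    "\<And>H \<psi> z. (\<forall>w\<in>F. (\<Sum>u\<in>?U. \<psi> u * w H u) = 0) \<Longrightarrow>
          (\<forall>s<t. (\<Sum>u\<in>?U. coef V H k q s u * z u) = 0) \<Longrightarrow> (\<Sum>u\<in>?U. \<psi> u * z u) = 0"
    using gen unfolding kernel_generators_def by blast+
  have legs: "(\<lambda>H. \<Sum>u\<in>?U. leg V H k j t u * w H u) \<in> borel_measurable ?M"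
      "causal t (\<lambda>H. \<Sum>u\<in>?U. leg V H k j t u * w H u)" if w: "w \<in> F" and j: "j \<in> {1,2}" for w j
  proof -
    show "(\<lambda>H. \<Sum>u\<in>?U. leg V H k j t u * w H u) \<in> borel_measurable ?M"
      using V_meas[OF t j] F(2)[OF w]
      by (intro borel_measurable_sum borel_measurable_times) (auto simp: leg_def)
    show "causal t (\<lambda>H. \<Sum>u\<in>?U. leg V H k j t u * w H u)"
      unfolding causal_def
    proof (intro allI impI sum.cong refl arg_cong2[of _ _ _ _ "(*)"])
      fix H H' :: "nat \<times> nat \<times> nat \<Rightarrow> complex" and u
      assume *: "\<forall>i. fst i < t \<longrightarrow> H i = H' i" "u \<in> ?U"
      show "leg V H k j t u = leg V H' k j t u"
        using causalD[OF V_causal[OF t j], of H H' "snd u"] * by (simp add: leg_def)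
      show "w H u = w H' u"
        using causalD[of t "\<lambda>H. w H u" H H'] F(2)[OF w] * by simp
    qed
  qed
  have "AE H in ?M. \<forall>w\<in>F.
      H (t,q,1) * (\<Sum>u\<in>?U. leg V H k 1 t u * w H u) + H (t,q,2) * (\<Sum>u\<in>?U. leg V H k 2 t u * w H u) = 0
      \<longrightarrow> (\<Sum>u\<in>?U. leg V H k 1 t u * w H u) = 0 \<and> (\<Sum>u\<in>?U. leg V H k 2 t u * w H u) = 0"
    using F(1)
  proof (intro AE_finite_allI)
    fix w assume w: "w \<in> F"
    show "AE H in ?M.
      H (t,q,1) * (\<Sum>u\<in>?U. leg V H k 1 t u * w H u) + H (t,q,2) * (\<Sum>u\<in>?U. leg V H k 2 t u * w H u) = 0
      \<longrightarrow> (\<Sum>u\<in>?U. leg V H k 1 t u * w H u) = 0 \<and> (\<Sum>u\<in>?U. leg V H k 2 t u * w H u) = 0"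
      using legs[OF w] q t
      by (intro AE_coord_combination causal_upd[OF legs(2)[OF w]]) (auto simp: chan_idx_def)
  qed
  then show ?thesis
  proof eventually_elim
    case (elim H)
    show ?case
    proof (intro impI allI ballI)
      fix z j
      assume silent: "\<forall>z. (\<forall>s<t. (\<Sum>u\<in>?U. coef V H k q s u * z u) = 0) \<longrightarrow>
          (\<Sum>u\<in>?U. coef V H k q t u * z u) = 0"
        and z: "\<forall>s<t. (\<Sum>u\<in>?U. coef V H k q s u * z u) = 0" and j: "j \<in> {1,2::nat}"
      have "(\<Sum>u\<in>?U. leg V H k j t u * w H u) = 0" if w: "w \<in> F" for w
      proof -
        have "(\<Sum>u\<in>?U. coef V H k q t u * w H u) = 0"
          using silent F(3)[OF w] by blast
        then show ?thesis
          using elim w j unfolding coef_sum by auto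
      qed
      then show "(\<Sum>u\<in>?U. leg V H k j t u * z u) = 0"
        using F(4)[of "leg V H k j t" H z] z by blast
    qed
  qed
qed

end

section \<open>Converse\<close>

text \<open>The part of the converse for a fixed realisation. With \<open>M\<close>,
  \<open>M'\<close> symbols for receivers \<open>k\<close> and \<open>3-k\<close>, it combines
  \<open>2 * M <= 3 * card T\<close> and \<open>M' + card T <= n\<close>; a violation of either
  gives a homogeneous system with a nonzero solution, against decodability.\<close>

lemma decodable_signal_dimension:
  assumes dec: "decodable n m V H" and k: "k \<in> {1,2}"
    and nz: "\<And>t j. t < n \<Longrightarrow> j \<in> {1,2} \<Longrightarrow> H (t,3-k,j) \<noteq> 0"
    and silent: "\<And>t. t < n \<Longrightarrow>
      (\<forall>z. (\<forall>s<t. (\<Sum>u\<in>syms m k. coef V H k (3-k) s u * z u) = 0) \<longrightarrow>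
          (\<Sum>u\<in>syms m k. coef V H k (3-k) t u * z u) = 0) \<longrightarrow>
      (\<forall>z. (\<forall>s<t. (\<Sum>u\<in>syms m k. coef V H k (3-k) s u * z u) = 0) \<longrightarrow>
          (\<forall>j\<in>{1,2}. (\<Sum>u\<in>syms m k. leg V H k j t u * z u) = 0))"
  shows "2 * (m k 1 + m k 2) + 3 * (m (3-k) 1 + m (3-k) 2) \<le> 3 * n"
proof -
  define q where "q = 3 - k"
  have q: "q \<in> {1,2}" "3 - q = k" "q \<noteq> k" using k by (auto simp: q_def)
  let ?U = "syms m k"
  define row where "row r t z = (\<Sum>u\<in>?U. coef V H k r t u * z u)" for r t z
  define part where "part j t z = (\<Sum>u\<in>?U. leg V H k j t u * z u)" for j t z
  \<comment> \<open>The times whose row at receiver \<open>q\<close> is not a combination of the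
    earlier rows, so \<open>card T\<close> is the dimension of the interference.\<close>
  define T where "T = {t. t < n \<and> (\<exists>z. (\<forall>s<t. row q s z = 0) \<and> row q t z \<noteq> 0)}"
  have finT: "finite T" by (simp add: T_def)
  have row_part: "row r t z = H (t,r,1) * part 1 t z + H (t,r,2) * part 2 t z" for r t z
    unfolding row_def part_def by (rule coef_sum)
  have part_0: "part j t z = 0" if "t < n" "t \<notin> T" "\<forall>s<n. row q s z = 0" "j \<in> {1,2}" for j t z
    using silent[OF that(1)] that unfolding T_def row_def part_def q_def by auto
  have row_0: "row q t z = 0" if T0: "\<forall>s\<in>T. row q s z = 0" and "t < n" for t z
    using \<open>t < n\<close>
  proof (induction t rule: less_induct)
    case (less t)
    show ?case
    proof (cases "t \<in> T")
      case False
      then show ?thesis using less by (auto simp: T_def)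
    qed (use T0 in blast)
  qed
  have dec_k: "z u = 0" if z: "\<forall>t<n. row k t z = 0" and u: "u \<in> ?U" for z u
  proof -
    define x where "x a b c = (if a = k then z (b,c) else 0)" for a b c :: nat
    have "received m V H k x t = row k t z" for t
      unfolding received_eq[OF k] row_def using q by (simp add: x_def flip: q_def)
    then have "\<forall>j\<in>{1,2}. \<forall>c<m k j. x k j c = 0"
      using dec[unfolded decodable_iff, rule_format, OF k, of x] z by simp
    then show ?thesis using u by (auto simp: x_def syms_def)
  qed
  have parts_0: "z u = 0" if z: "\<forall>t<n. part 1 t z = 0 \<and> part 2 t z = 0" and "u \<in> ?U" for z u
    using dec_k[OF _ that(2), of z] z by (simp add: row_part)

  have "2 * (m k 1 + m k 2) \<le> 3 * card T"
  proof (rule ccontr)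
    assume "\<not> ?thesis"
    then have card: "card (T \<times> {0,1,2::nat}) < card (?U \<times> {1,2::nat})"
      using finT finite_syms by (simp add: card_cartesian_product card_syms)
    \<comment> \<open>The unknowns are two copies \<open>z 1\<close>, \<open>z 2\<close> of the
      symbol vector. Equations \<open>(t,1)\<close> and \<open>(t,2)\<close> silence receiver
      \<open>q\<close> on each copy; \<open>(t,0)\<close> silences receiver \<open>k\<close> on
      \<open>zm\<close>, which takes the symbols of transmitter \<open>j\<close> from
      \<open>z j\<close>.\<close>
    define A where "A e v =
      (if snd e = 0 then if fst (fst v) = snd v then coef V H k k (fst e) (fst v) else 0
       else if snd e = snd v then coef V H k q (fst e) (fst v) else 0)"
      for e :: "nat \<times> nat" and v :: "(nat \<times> nat) \<times> nat"
    obtain x where x: "\<exists>v\<in>?U \<times> {1,2}. x v \<noteq> 0"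
      "\<And>e. e \<in> T \<times> {0,1,2} \<Longrightarrow> (\<Sum>v\<in>?U \<times> {1,2}. A e v * x v) = 0"
      using underdetermined_system_nontrivial[OF _ _ card, of A] finT finite_syms by blast
    define z where "z i u = x (u, i)" for i u
    define zm where "zm u = z (fst u) u" for u
    have sum2: "(\<Sum>v\<in>?U \<times> {1,2::nat}. f v) = (\<Sum>u\<in>?U. f (u,1) + f (u,2))" for f :: "_ \<Rightarrow> complex"
      by (simp add: sum.cartesian_product' del: One_nat_def)
    have z_ker: "\<forall>t<n. row q t (z i) = 0" if i: "i \<in> {1,2}" for i
    proof -
      have "row q t (z i) = 0" if t: "t \<in> T" for t
        using x(2)[of "(t,i)"] t i unfolding sum2 by (auto simp: A_def row_def z_def)
      then show ?thesis using row_0 by blast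
    qed
    have part_zm: "part j t zm = part j t (z j)" for j t
      unfolding part_def by (intro sum.cong) (auto simp: leg_def zm_def)
    have "row k t zm = 0" if t: "t < n" for t
    proof (cases "t \<in> T")
      case True
      have "row k t zm = (\<Sum>v\<in>?U \<times> {1,2}. A (t,0) v * x v)"
        unfolding sum2 row_def
        by (intro sum.cong) (auto simp: A_def zm_def z_def dest: fst_syms)
      then show ?thesis using x(2)[of "(t,0)"] True by simp
    next
      case False
      have "part j t zm = 0" if "j \<in> {1,2}" for j
        unfolding part_zm using part_0[OF t False z_ker[OF that] that] .
      then show ?thesis by (simp add: row_part)
    qed
    then have zm0: "zm u = 0" if "u \<in> ?U" for u using dec_k that by blast
    then have own: "part j t (z j) = 0" for j t
      unfolding part_zm[symmetric] by (simp add: part_def)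
    \<comment> \<open>On \<open>z i\<close> transmitter \<open>i\<close> contributes nothing;
      receiver \<open>q\<close> is silent and its gains are nonzero, so the other transmitter
      contributes nothing either.\<close>
    have "z i u = 0" if i: "i \<in> {1,2}" and u: "u \<in> ?U" for i u
    proof (rule parts_0[OF _ u], intro allI impI)
      fix t assume t: "t < n"
      then show "part 1 t (z i) = 0 \<and> part 2 t (z i) = 0"
        using z_ker[OF i] own[of i t] i nz[OF t, of 1] nz[OF t, of 2]
        by (auto simp: row_part simp flip: q_def)
    qed
    then show False using x(1) by (auto simp: z_def)
  qed
  moreover have "m q 1 + m q 2 + card T \<le> n"
  proof (rule ccontr)
    assume large: "\<not> ?thesis"
    have "\<exists>z. (\<forall>s<t. row q s z = 0) \<and> row q t z \<noteq> 0" if "t \<in> T" for t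
      using that by (simp add: T_def)
    then obtain b where b: "\<And>t s. t \<in> T \<Longrightarrow> s < t \<Longrightarrow> row q s (b t) = 0"
        "\<And>t. t \<in> T \<Longrightarrow> row q t (b t) \<noteq> 0"
      by metis
    \<comment> \<open>The unknowns are the symbols wanted at \<open>q\<close> and one coefficient
      for each interference vector \<open>b s\<close>; a solution is an assignment that
      \<open>q\<close> receives as zero.\<close>
    define A where "A t v = (case v of Inl u \<Rightarrow> coef V H q q t u | Inr s \<Rightarrow> row q t (b s))" for t v
    have "card {..<n} < card (syms m q <+> T)"
      using large finT finite_syms by (simp add: card_Plus card_syms)
    then obtain y where y: "\<exists>v\<in>syms m q <+> T. y v \<noteq> 0"
      "\<And>t. t < n \<Longrightarrow> (\<Sum>v\<in>syms m q <+> T. A t v * y v) = 0"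
      using underdetermined_system_nontrivial[of "{..<n}" "syms m q <+> T" A] finT finite_syms
      by auto
    define x where "x i j c = (if i = q then y (Inl (j,c)) else (\<Sum>s\<in>T. y (Inr s) * b s (j,c)))"
      for i j c :: nat
    have row_b: "(\<Sum>u\<in>?U. coef V H k q t u * (\<Sum>s\<in>T. y (Inr s) * b s u))
        = (\<Sum>s\<in>T. y (Inr s) * row q t (b s))" for t
      unfolding row_def sum_distrib_left by (subst sum.swap) (simp add: mult_ac)
    have plus: "(\<Sum>v\<in>syms m q <+> T. A t v * y v)
        = (\<Sum>u\<in>syms m q. coef V H q q t u * y (Inl u)) + (\<Sum>s\<in>T. y (Inr s) * row q t (b s))" for t
      using finT finite_syms by (subst sum.Plus) (auto simp: A_def mult.commute)
    have "received m V H q x t = (\<Sum>v\<in>syms m q <+> T. A t v * y v)" for t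
      unfolding received_eq[OF q(1)] plus q(2) row_b[symmetric] using q(3) by (simp add: x_def)
    then have "\<forall>j\<in>{1,2}. \<forall>c<m q j. x q j c = 0"
      using dec[unfolded decodable_iff, rule_format, OF q(1), of x] y(2) by simp
    then have yl: "y (Inl u) = 0" if "u \<in> syms m q" for u
      using that by (auto simp: x_def syms_def)
    \<comment> \<open>Forward substitution: \<open>row q t (b s)\<close> is triangular over
      \<open>T\<close> with nonzero diagonal.\<close>
    have yr: "y (Inr s) = 0" if "s \<in> T" for s
      using that
    proof (induction s rule: less_induct)
      case (less s)
      then have "s < n" by (simp add: T_def)
      have "y (Inr s') * row q s (b s') = 0" if "s' \<in> T - {s}" for s'
        using less.IH[of s'] b(1)[of s' s] that by (cases s' s rule: linorder_cases) auto
      then have "(\<Sum>s'\<in>T. y (Inr s') * row q s (b s')) = y (Inr s) * row q s (b s)"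
        using less.prems finT by (subst sum.remove[of _ s]) (simp_all add: sum.neutral)
      moreover have "(\<Sum>s'\<in>T. y (Inr s') * row q s (b s')) = 0"
        using y(2)[OF \<open>s < n\<close>] unfolding plus by (simp add: yl)
      ultimately show ?case using b(2)[OF less.prems] by simp
    qed
    show False using y(1) yl yr by auto
  qed
  moreover have "2 * a \<le> 3 * d \<Longrightarrow> b + d \<le> n \<Longrightarrow> 2 * a + 3 * b \<le> 3 * n" for a b d :: nat
    by linarith
  ultimately show ?thesis unfolding q_def by blast
qed

context channel_law begin

lemma AE_coord_nonzero: "AE H in chan_space \<mu> n. \<forall>i\<in>chan_idx n. H i \<noteq> 0"
  using AE_coord_neq[of _ n "\<lambda>_. 0"] finite_chan_idx by (intro AE_finite_allI) auto

text \<open>The inequality does not mention \<open>H\<close>, so in a probability space its almost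
  sure truth is its truth.\<close>

lemma decodable_sum_bound:
  assumes V: "delayed_csit \<mu> n V" and dec: "AE H in chan_space \<mu> n. decodable n m V H"
  shows "5 * (m 1 1 + m 1 2 + m 2 1 + m 2 2) \<le> 6 * n"
proof -
  interpret C: prob_space "chan_space \<mu> n"
    unfolding chan_space_def by (rule prob_space_PiM) unfold_locales
  have "AE H in chan_space \<mu> n. \<forall>k\<in>{1,2}. \<forall>t\<in>{..<n}.
      (\<forall>z. (\<forall>s<t. (\<Sum>u\<in>syms m k. coef V H k (3-k) s u * z u) = 0) \<longrightarrow>
          (\<Sum>u\<in>syms m k. coef V H k (3-k) t u * z u) = 0) \<longrightarrow>
      (\<forall>z. (\<forall>s<t. (\<Sum>u\<in>syms m k. coef V H k (3-k) s u * z u) = 0) \<longrightarrow>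
          (\<forall>j\<in>{1,2}. (\<Sum>u\<in>syms m k. leg V H k j t u * z u) = 0))"
    using V by (intro AE_finite_allI AE_silent_row_legs_vanish) auto
  with dec AE_coord_nonzero[of n]
  have "AE H in chan_space \<mu> n. 5 * (m 1 1 + m 1 2 + m 2 1 + m 2 2) \<le> 6 * n"
  proof eventually_elim
    case (elim H)
    have nz: "H (t,3-k,j) \<noteq> 0" if "k \<in> {1,2}" "t < n" "j \<in> {1,2}" for k t j
      using elim(2) that by (auto simp: chan_idx_def)
    have "2 * (m k 1 + m k 2) + 3 * (m (3-k) 1 + m (3-k) 2) \<le> 3 * n" if k: "k \<in> {1,2}" for k
      using elim(1) k nz[OF k] elim(3)[rule_format, OF k]
      by (intro decodable_signal_dimension[of n m V H k]) (auto simp del: insert_iff)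
    from this[of 1] this[of 2] show ?case by simp
  qed
  then show ?thesis by simp
qed

text \<open>A non-strict linear bound survives both the limit of the normalised loads and the
  closure.\<close>

lemma sum_DoF_le:
  assumes "(d11, d12, d21, d22) \<in> DoF_region \<mu>"
  shows "d11 + d12 + d21 + d22 \<le> 6/5"
proof -
  let ?C = "{d :: real \<times> real \<times> real \<times> real. fst d + fst (snd d) + fst (snd (snd d)) + snd (snd (snd d)) \<le> 6/5}"
  have "closed ?C"
    by (intro closed_Collect_le continuous_intros)
  moreover have "lin_achievable \<mu> \<subseteq> ?C"
  proof safe
    fix a b c d assume "(a, b, c, d) \<in> lin_achievable \<mu>"
    then obtain m V where V: "\<And>n. delayed_csit \<mu> n (V n)"
      and dec: "\<And>n. AE H in chan_space \<mu> n. decodable n (m n) (V n) H"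
      and lim: "(\<lambda>n. real (m n 1 1) / real n) \<longlonglongrightarrow> a" "(\<lambda>n. real (m n 1 2) / real n) \<longlonglongrightarrow> b"
        "(\<lambda>n. real (m n 2 1) / real n) \<longlonglongrightarrow> c" "(\<lambda>n. real (m n 2 2) / real n) \<longlonglongrightarrow> d"
      unfolding lin_achievable_def by auto
    have "(\<lambda>n. real (m n 1 1) / real n + real (m n 1 2) / real n + real (m n 2 1) / real n
        + real (m n 2 2) / real n) \<longlonglongrightarrow> a + b + c + d"
      by (intro tendsto_add lim)
    moreover have "real (m n 1 1) / real n + real (m n 1 2) / real n + real (m n 2 1) / real n
        + real (m n 2 2) / real n \<le> 6/5" if "n \<ge> 1" for n
    proof -
      have "5 * (real (m n 1 1) + real (m n 1 2) + real (m n 2 1) + real (m n 2 2)) \<le> 6 * real n"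
        using of_nat_mono[OF decodable_sum_bound[OF V dec, of n], where 'a = real] by simp
      then show ?thesis using that by (simp add: field_simps)
    qed
    ultimately have "a + b + c + d \<le> 6/5"
      by (intro LIMSEQ_le_const2 exI[of _ 1]) blast+
    then show "fst (a,b,c,d) + fst (snd (a,b,c,d)) + fst (snd (snd (a,b,c,d)))
        + snd (snd (snd (a,b,c,d))) \<le> 6/5" by simp
  qed
  ultimately have "DoF_region \<mu> \<subseteq> ?C"
    unfolding DoF_region_def by (intro closure_minimal)
  then show ?thesis using assms by auto
qed

end

section \<open>Achievability\<close>

text \<open>Block \<open>b\<close> occupies times \<open>5b, \<dots>, 5b+4\<close> and carries three symbols per receiver.  In the two slots
  reserved for receiver \<open>k\<close>, transmitter 1 sends two fresh symbols while transmitter 2 repeats one.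
  The other receiver eliminates the repeated symbol and is left with a combination of the two fresh ones;
  in the last slot transmitter 1 sends the sum of these two combinations, each of which is new to
  one receiver and already known to the other.\<close>

definition slot :: "nat \<Rightarrow> nat \<Rightarrow> nat" where
  "slot b k = 5 * b + 2 * (k - 1)"

text \<open>The products in slot \<open>5 * b + 4\<close> are the coefficients of the fresh symbols
  that remain when receiver \<open>3-k\<close> eliminates the repeated symbol from its observations
  at \<open>s\<close> and \<open>s+1\<close>. They use only past gains.\<close>

definition block_precoder ::
  "nat \<Rightarrow> nat \<Rightarrow> nat \<Rightarrow> (nat \<times> nat \<times> nat \<Rightarrow> complex) \<Rightarrow> nat \<Rightarrow> complex" where
  "block_precoder k j t H c = (let b = t div 5; s = slot b k in
     if j = 1 then
       if t = s \<and> c = 2 * b \<or> t = s + 1 \<and> c = 2 * b + 1 then 1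
       else if t = 5 * b + 4 \<and> c = 2 * b then H (s, 3-k, 1) * H (s+1, 3-k, 2)
       else if t = 5 * b + 4 \<and> c = 2 * b + 1 then - (H (s+1, 3-k, 1) * H (s, 3-k, 2))
       else 0
     else if (t = s \<or> t = s + 1) \<and> c = b then 1 else 0)"

text \<open>In an incomplete final block the indices served by \<open>block_precoder\<close> lie
  beyond the load, so nothing is sent there.\<close>

definition block_load :: "nat \<Rightarrow> nat \<Rightarrow> nat \<Rightarrow> nat" where
  "block_load n k j = (if j = 1 then 2 * (n div 5) else n div 5)"

lemma sent_block_1:
  assumes "b < n div 5" "t div 5 = b"
  shows "sent (block_load n) block_precoder H k 1 x t =
    block_precoder k 1 t H (2*b) * x k 1 (2*b) + block_precoder k 1 t H (2*b+1) * x k 1 (2*b+1)"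
proof -
  have "sent (block_load n) block_precoder H k 1 x t
      = (\<Sum>c\<in>{2*b, 2*b+1}. block_precoder k 1 t H c * x k 1 c)"
    unfolding sent_def using assms
    by (intro sum.mono_neutral_right) (auto simp: block_load_def block_precoder_def Let_def)
  then show ?thesis by simp
qed

lemma sent_block_2:
  assumes "b < n div 5" "t div 5 = b"
  shows "sent (block_load n) block_precoder H k 2 x t = block_precoder k 2 t H b * x k 2 b"
proof -
  have "sent (block_load n) block_precoder H k 2 x t
      = (\<Sum>c\<in>{b}. block_precoder k 2 t H c * x k 2 c)"
    unfolding sent_def using assms
    by (intro sum.mono_neutral_right) (auto simp: block_load_def block_precoder_def Let_def)
  then show ?thesis by simp
qed

lemma block_precoder_slot:
  assumes "k \<in> {1,2}" "i \<in> {1,2}" "d \<in> {0,1}"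
  shows "e \<in> {0,1} \<Longrightarrow> block_precoder i 1 (slot b k + d) H (2*b+e) = (if i = k \<and> d = e then 1 else 0)"
    and "block_precoder i 2 (slot b k + d) H b = (if i = k then 1 else 0)"
proof -
  have b: "(slot b k + d) div 5 = b" using assms by (auto simp: slot_def)
  have eq: "slot b k + d = slot b i + f \<longleftrightarrow> i = k \<and> d = f" if "f \<in> {0,1}" for f
    using assms that by (auto simp: slot_def)
  have last: "slot b k + d \<noteq> 5 * b + 4"
    using assms by (auto simp: slot_def)
  show "block_precoder i 1 (slot b k + d) H (2*b+e) = (if i = k \<and> d = e then 1 else 0)" if "e \<in> {0,1}"
    unfolding block_precoder_def Let_def b using last eq[of 0] eq[of 1] that assms(3) by auto
  show "block_precoder i 2 (slot b k + d) H b = (if i = k then 1 else 0)"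
    unfolding block_precoder_def Let_def b using eq[of 0] eq[of 1] assms(3) by auto
qed

lemma block_precoder_last:
  assumes "i \<in> {1,2}"
  shows "block_precoder i 1 (5*b+4) H (2*b) = H (slot b i, 3-i, 1) * H (slot b i + 1, 3-i, 2)"
    and "block_precoder i 1 (5*b+4) H (2*b+1) = - (H (slot b i + 1, 3-i, 1) * H (slot b i, 3-i, 2))"
    and "block_precoder i 2 (5*b+4) H c = 0"
proof -
  have b: "(5*b+4) div 5 = b" by simp
  have "5*b+4 \<noteq> slot b i" "5*b+4 \<noteq> slot b i + 1"
    using assms by (auto simp: slot_def)
  then show "block_precoder i 1 (5*b+4) H (2*b) = H (slot b i, 3-i, 1) * H (slot b i + 1, 3-i, 2)"
    "block_precoder i 1 (5*b+4) H (2*b+1) = - (H (slot b i + 1, 3-i, 1) * H (slot b i, 3-i, 2))"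
    "block_precoder i 2 (5*b+4) H c = 0"
    unfolding block_precoder_def Let_def b by simp_all
qed

text \<open>Three equations determine the three wanted symbols of a block: the two reserved slots,
  and the last slot once its interference is removed. Hypothesis \<open>gen\<close> says that their
  determinant is nonzero, solved for one gain so that it has the form of
  \<open>AE_coord_neq\<close>.\<close>

lemma decodable_block_scheme:
  assumes nz: "\<forall>i\<in>chan_idx n. H i \<noteq> 0"
    and gen: "\<forall>k\<in>{1,2}. \<forall>b<n div 5. let s = slot b k in
      H (s+1,3-k,2) \<noteq> H (s,3-k,2) * H (s+1,3-k,1) * H (s+1,k,2) * H (s,k,1)
         / (H (s,3-k,1) * H (s,k,2) * H (s+1,k,1))"
  shows "decodable n (block_load n) block_precoder H"
  unfolding decodable_iff
proof (intro ballI allI impI)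
  fix k j c and x :: "nat \<Rightarrow> nat \<Rightarrow> nat \<Rightarrow> complex"
  assume k: "k \<in> {1,2}" and j: "j \<in> {1,2}" and c: "c < block_load n k j"
    and rx: "\<forall>t<n. received (block_load n) block_precoder H k x t = 0"
  define k' where "k' = 3 - k"
  have k': "k' \<in> {1,2}" "3 - k' = k" "k' \<noteq> k" using k by (auto simp: k'_def)
  have block: "x k 1 (2*b) = 0 \<and> x k 1 (2*b+1) = 0 \<and> x k 2 b = 0" if b: "b < n div 5" for b
  proof -
    define s s' f where "s = slot b k" and "s' = slot b k'" and "f = 5 * b + 4"
    have dv: "s div 5 = b" "(s+1) div 5 = b" "s' div 5 = b" "(s'+1) div 5 = b" "f div 5 = b"
      using k k'(1) by (auto simp: s_def s'_def f_def slot_def)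
    have "5 * b + 4 < n" using b by linarith
    then have lt: "s < n" "s + 1 < n" "s' < n" "s' + 1 < n" "f < n"
      using k k'(1) by (auto simp: s_def s'_def f_def slot_def)
    have h: "H (t,r,i) \<noteq> 0" if "t < n" "r \<in> {1,2}" "i \<in> {1,2}" for t r i
      using nz that by (auto simp: chan_idx_def)
    have rx': "H (t,k,1) * (sent (block_load n) block_precoder H k 1 x t
          + sent (block_load n) block_precoder H k' 1 x t)
        + H (t,k,2) * (sent (block_load n) block_precoder H k 2 x t
          + sent (block_load n) block_precoder H k' 2 x t) = 0" if "t < n" for t
      using rx that received_split[OF k, of 1 "block_load n" block_precoder H k x t]
      by (simp add: k'_def)
    have own: "H (s+d,k,1) * x k 1 (2*b+d) + H (s+d,k,2) * x k 2 b = 0"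
      and other: "H (s'+d,k,1) * x k' 1 (2*b+d) + H (s'+d,k,2) * x k' 2 b = 0"
      if d: "d \<in> {0,1}" for d
    proof -
      have "(s+d) div 5 = b" "(s'+d) div 5 = b" "s+d < n" "s'+d < n" using d dv lt by auto
      note * = rx'[OF this(3)] rx'[OF this(4)] sent_block_1[OF b this(1)] sent_block_2[OF b this(1)]
        sent_block_1[OF b this(2)] sent_block_2[OF b this(2)]
      note p = block_precoder_slot[OF _ _ d]
      show "H (s+d,k,1) * x k 1 (2*b+d) + H (s+d,k,2) * x k 2 b = 0"
        using *(1) d k'(3)
          p(1)[OF k k, of 0 b H] p(1)[OF k k, of 1 b H] p(2)[OF k k, of b H]
          p(1)[OF k k'(1), of 0 b H] p(1)[OF k k'(1), of 1 b H] p(2)[OF k k'(1), of b H]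
        unfolding *(3,4) s_def[symmetric] by auto
      show "H (s'+d,k,1) * x k' 1 (2*b+d) + H (s'+d,k,2) * x k' 2 b = 0"
        using *(2) d k'(3)
          p(1)[OF k'(1) k, of 0 b H] p(1)[OF k'(1) k, of 1 b H] p(2)[OF k'(1) k, of b H]
          p(1)[OF k'(1) k'(1), of 0 b H] p(1)[OF k'(1) k'(1), of 1 b H] p(2)[OF k'(1) k'(1), of b H]
        unfolding *(5,6) s'_def[symmetric] by auto
    qed
    have e1: "H (s,k,1) * x k 1 (2*b) + H (s,k,2) * x k 2 b = 0"
      and e2: "H (s+1,k,1) * x k 1 (2*b+1) + H (s+1,k,2) * x k 2 b = 0"
      and e3: "H (s',k,1) * x k' 1 (2*b) + H (s',k,2) * x k' 2 b = 0"
      and e4: "H (s'+1,k,1) * x k' 1 (2*b+1) + H (s'+1,k,2) * x k' 2 b = 0"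
      using own[of 0] own[of 1] other[of 0] other[of 1] by simp_all
    note pre_f = block_precoder_last[of _ b H, folded f_def]
    have "H (f,k,1) * (H (s,k',1) * H (s+1,k',2) * x k 1 (2*b) - H (s+1,k',1) * H (s,k',2) * x k 1 (2*b+1)
        + (H (s',k,1) * H (s'+1,k,2) * x k' 1 (2*b) - H (s'+1,k,1) * H (s',k,2) * x k' 1 (2*b+1))) = 0"
      using rx'[OF lt(5)] unfolding sent_block_1[OF b dv(5)] sent_block_2[OF b dv(5)]
        pre_f[OF k] pre_f[OF k'(1)] s_def[symmetric] s'_def[symmetric] k'(2) k'_def[symmetric]
      by (simp add: algebra_simps)
    then have "H (s,k',1) * H (s+1,k',2) * x k 1 (2*b) - H (s+1,k',1) * H (s,k',2) * x k 1 (2*b+1)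
        + (H (s',k,1) * H (s'+1,k,2) * x k' 1 (2*b) - H (s'+1,k,1) * H (s',k,2) * x k' 1 (2*b+1)) = 0"
      using h[OF lt(5) k, of 1] by simp
    \<comment> \<open>The interfering part of the last slot is what receiver \<open>k\<close> gets
      by eliminating the repeated symbol from \<open>e3\<close> and \<open>e4\<close>.\<close>
    moreover have "H (s',k,1) * H (s'+1,k,2) * x k' 1 (2*b) - H (s'+1,k,1) * H (s',k,2) * x k' 1 (2*b+1) = 0"
      using e3 e4 by algebra
    ultimately have e5: "H (s,k',1) * H (s+1,k',2) * x k 1 (2*b) - H (s+1,k',1) * H (s,k',2) * x k 1 (2*b+1) = 0"
      by simp
    \<comment> \<open>Both fresh symbols are eliminated from \<open>e1\<close>, \<open>e2\<close>,
      \<open>e5\<close>; the factor is the determinant.\<close>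
    have "x k 2 b * (H (s+1,k',2) * (H (s,k',1) * H (s,k,2) * H (s+1,k,1))
        - H (s,k',2) * H (s+1,k',1) * H (s+1,k,2) * H (s,k,1)) = 0"
      using e1 e2 e5 by algebra
    moreover have "H (s+1,k',2) * (H (s,k',1) * H (s,k,2) * H (s+1,k,1))
        \<noteq> H (s,k',2) * H (s+1,k',1) * H (s+1,k,2) * H (s,k,1)"
      using gen[rule_format, OF k b] h[OF lt(1) k'(1), of 1] h[OF lt(1) k, of 2] h[OF lt(2) k, of 1]
      unfolding Let_def s_def[symmetric] k'_def[symmetric] by (simp add: nonzero_eq_divide_eq)
    ultimately have v: "x k 2 b = 0" by simp
    then show ?thesis
      using e1 e2 h[OF lt(1) k, of 1] h[OF lt(2) k, of 1] by simp
  qed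
  show "x k j c = 0"
  proof (cases "j = 1")
    case True
    then have "c div 2 < n div 5" using c by (auto simp: block_load_def)
    moreover have "c = 2 * (c div 2) \<or> c = 2 * (c div 2) + 1" by presburger
    ultimately show ?thesis using block[of "c div 2"] True by metis
  next
    case False
    then show ?thesis using block[of c] c j by (auto simp: block_load_def)
  qed
qed

section \<open>Rates, causality and almost sure decodability of the block scheme\<close>

lemma tendsto_div_5_over_self: "(\<lambda>n. real (n div 5) / real n) \<longlonglongrightarrow> 1/5"
proof (rule tendsto_sandwich)
  have "1/5 - 1 / real n \<le> real (n div 5) / real n \<and> real (n div 5) / real n \<le> 1/5" if "n > 0" for n
  proof -
    have "5 * (n div 5) \<le> n" "n \<le> 5 * (n div 5) + 5" by linarith+
    then have "5 * real (n div 5) \<le> real n" "real n \<le> 5 * real (n div 5) + 5" by linarith+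
    then have "(real n / 5 - 1) / real n \<le> real (n div 5) / real n"
      "real (n div 5) / real n \<le> (real n / 5) / real n"
      by (intro divide_right_mono; simp)+
    then show ?thesis using that by (simp add: diff_divide_distrib)
  qed
  then show "\<forall>\<^sub>F n in sequentially. 1/5 - 1 / real n \<le> real (n div 5) / real n"
    "\<forall>\<^sub>F n in sequentially. real (n div 5) / real n \<le> 1/5"
    by (auto intro!: eventually_mono[OF eventually_gt_at_top[of 0]])
  show "(\<lambda>n. 1/5 - 1 / real n) \<longlonglongrightarrow> 1/5"
    using tendsto_diff[OF tendsto_const lim_1_over_n, of "1/5::real"] by simp
qed simp

context channel_law begin

lemma delayed_csit_block_precoder: "delayed_csit \<mu> n block_precoder"
  unfolding delayed_csit_def
proof (intro ballI allI impI conjI)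
  fix k j t c :: nat and H H' :: "nat \<times> nat \<times> nat \<Rightarrow> complex"
  assume k: "k \<in> {1,2}" and t: "t < n"
  have past: "slot (t div 5) k + 1 < t" if "t = 5 * (t div 5) + 4"
    using k that by (auto simp: slot_def)
  {
    assume eq: "\<forall>s<t. \<forall>k'\<in>{1,2}. \<forall>j'\<in>{1,2}. H (s,k',j') = H' (s,k',j')"
    have "H (s,3-k,i) = H' (s,3-k,i)" if "s < t" "i \<in> {1,2}" for s i
      using eq k that by auto
    then show "block_precoder k j t H c = block_precoder k j t H' c"
      using past by (auto simp: block_precoder_def Let_def)
  }
  have coord: "(\<lambda>H. H (s,3-k,i)) \<in> borel_measurable (chan_space \<mu> n)" if "s < t" "i \<in> {1,2}" for s i
    using k t that by (intro measurable_coord) (auto simp: chan_idx_def)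
  show "(\<lambda>H. block_precoder k j t H c) \<in> borel_measurable (chan_space \<mu> n)"
  \<comment> \<open>Gains enter only in the last slot of a block, where \<open>past\<close> places
    the two earlier slots inside the block length. In the other slots the precoder is constant in
    \<open>H\<close>, with \<open>0\<close> as an arbitrary realisation.\<close>
  proof (cases "t = 5 * (t div 5) + 4")
    case True
    note [measurable] = coord[of "slot (t div 5) k" 1] coord[of "slot (t div 5) k" 2]
      coord[of "slot (t div 5) k + 1" 1] coord[of "slot (t div 5) k + 1" 2]
    have "slot (t div 5) k < t" "slot (t div 5) k + 1 < t" using past[OF True] by auto
    then show ?thesis unfolding block_precoder_def Let_def by measurable
  next
    case False
    then have "(\<lambda>H. block_precoder k j t H c) = (\<lambda>_. block_precoder k j t 0 c)"
      by (auto simp: block_precoder_def Let_def fun_eq_iff)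
    then show ?thesis by (metis borel_measurable_const)
  qed
qed

lemma AE_decodable_block_scheme:
  "AE H in chan_space \<mu> n. decodable n (block_load n) block_precoder H"
proof -
  have "AE H in chan_space \<mu> n. \<forall>k\<in>{1,2}. \<forall>b\<in>{..<n div 5}. let s = slot b k in
      H (s+1,3-k,2) \<noteq> H (s,3-k,2) * H (s+1,3-k,1) * H (s+1,k,2) * H (s,k,1)
         / (H (s,3-k,1) * H (s,k,2) * H (s+1,k,1))"
  proof (intro AE_finite_allI)
    fix k b :: nat assume k: "k \<in> {1,2}" and b: "b \<in> {..<n div 5}"
    define s where "s = slot b k"
    have "5 * b + 4 < n" using b by auto
    then have s: "s + 1 < n" using k by (auto simp: s_def slot_def)
    have idx: "(t, r, i) \<in> chan_idx n" if "t \<in> {s, s+1}" "r \<in> {k, 3-k}" "i \<in> {1,2}" for t r i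
      using that s k by (auto simp: chan_idx_def)
    have "AE H in chan_space \<mu> n.
      H (s+1,3-k,2) \<noteq> H (s,3-k,2) * H (s+1,3-k,1) * H (s+1,k,2) * H (s,k,1)
         / (H (s,3-k,1) * H (s,k,2) * H (s+1,k,1))"
    \<comment> \<open>The gain on the left does not occur on the right, as \<open>k\<close> and
      \<open>3-k\<close> differ.\<close>
    proof (rule AE_coord_neq)
      show "(s+1, 3-k, 2) \<in> chan_idx n" by (intro idx) auto
      show "(\<lambda>H. H (s,3-k,2) * H (s+1,3-k,1) * H (s+1,k,2) * H (s,k,1)
         / (H (s,3-k,1) * H (s,k,2) * H (s+1,k,1))) \<in> borel_measurable (chan_space \<mu> n)"
        by (intro borel_measurable_divide borel_measurable_times measurable_coord idx) auto
    qed (use k in auto)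
    then show "AE H in chan_space \<mu> n. let s = slot b k in
      H (s+1,3-k,2) \<noteq> H (s,3-k,2) * H (s+1,3-k,1) * H (s+1,k,2) * H (s,k,1)
         / (H (s,3-k,1) * H (s,k,2) * H (s+1,k,1))"
      unfolding Let_def s_def .
  qed auto
  with AE_coord_nonzero[of n] show ?thesis
  proof eventually_elim
    case (elim H)
    then show ?case by (intro decodable_block_scheme) (simp_all del: insert_iff)
  qed
qed

lemma block_scheme_achieves: "(2/5, 1/5, 2/5, 1/5) \<in> lin_achievable \<mu>"
proof -
  have "(\<lambda>n. real (block_load n k 2) / real n) \<longlonglongrightarrow> 1/5" for k
    using tendsto_div_5_over_self by (simp add: block_load_def)
  moreover have "(\<lambda>n. real (block_load n k 1) / real n) \<longlonglongrightarrow> 2/5" for k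
    using tendsto_mult[OF tendsto_const[of 2] tendsto_div_5_over_self] by (simp add: block_load_def)
  ultimately show ?thesis
    unfolding lin_achievable_def
    using delayed_csit_block_precoder AE_decodable_block_scheme
    by (intro CollectI case_prodI exI[of _ block_load] exI[of _ "\<lambda>_. block_precoder"]) auto
qed

end

theorem theorem1:
  fixes \<mu> :: "complex measure"
  assumes "prob_space \<mu>"
    and "sets \<mu> = sets borel"
    and "absolutely_continuous lborel \<mu>"
  shows "(\<exists>(d11, d12, d21, d22) \<in> DoF_region \<mu>. d11 + d12 + d21 + d22 = 6/5)
       \<and> (\<forall>(d11, d12, d21, d22) \<in> DoF_region \<mu>. d11 + d12 + d21 + d22 \<le> 6/5)"
proof -
  interpret channel_law \<mu>
    using assms by (simp add: channel_law_def channel_law_axioms_def)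
  have "(2/5, 1/5, 2/5, 1/5) \<in> DoF_region \<mu>"
    using block_scheme_achieves closure_subset unfolding DoF_region_def by blast
  then show ?thesis
    using sum_DoF_le by (auto intro!: bexI[of _ "(2/5, 1/5, 2/5, 1/5)"])
qed

end
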